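(* Let $n=2$. Under the specialization $(s_1,s_2)=(1,t)$, the first eigenfunction $f_0(\zeta_1,\zeta_2)$ of $I(\alpha)$ is the infinite product $$f_0(\zeta_1,\zeta_2)\Big|_{(s_1,s_2)=(1,t)}=(1-\zeta_2/\zeta_1)\frac{(qt^{-1}\zeta_2/\zeta_1;q)_\infty}{(t\zeta_2/\zeta_1;q)_\infty}.$$
   Context: Notation: $(a;q)_\infty=\prod_{k\ge 0}(1-aq^k)$, $(a;q)_k=\prod_{i=0}^{k-1}(1-aq^i)$, $\Theta_q(z)=(z;q)_\infty(q/z;q)_\infty(q;q)_\infty$. The parameters are complex with $0<|q|<1$, $t\ne0$, $|qt^{-1}|<1$, fixed square roots $q^{1/2},t^{1/2}$, otherwise generic. The integral transformation $I(\alpha)=I(\alpha;s_1,s_2,q,t)$ acts on ${\bf C}[[\zeta_2/\zeta_1]]$ by (with $n=2$) $$I(\alpha) f(\zeta_1,\dots,\zeta_n)=\prod_{i=1}^n\frac{(qt^{-1};q)_\infty(q;q)_\infty}{(\alpha s_i^{-1}qt^{-1};q)_\infty(\alpha^{-1}s_iq;q)_\infty}\prod_{i<j}h(\zeta_j/\zeta_i)\oint\!\cdots\!\oint\prod_{i=1}^n\frac{d\xi_i}{2\pi i\,\xi_i}\prod_{i=1}^n\frac{\Theta_q(\alpha s_i^{-1}q^{1/2}t^{-1/2}\zeta_i/\xi_i)}{\Theta_q(q^{1/2}t^{-1/2}\zeta_i/\xi_i)}\prod_{k=1}^n\Big[\prod_{i<k}g(\zeta_k/\xi_i)\prod_{j\ge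 k}g(\xi_j/\zeta_k)\Big]f(\xi_1,\dots,\xi_n),$$ contours $|\zeta_i/\xi_i|=1$ (substitute $\xi_i=\zeta_iu_i$, expand in powers of $\zeta_2/\zeta_1$, and integrate termwise over $|u_i|=1$), with $h(\zeta)=(1-\zeta)\frac{(qt^{-1}\zeta;q)_\infty}{(t\zeta;q)_\infty}$, $g(\zeta)=\frac{(q^{1/2}t^{1/2}\zeta;q)_\infty}{(q^{1/2}t^{-1/2}\zeta;q)_\infty}$. The first eigenfunction $f_0$ is the eigenfunction of $I(\alpha)$ in ${\bf C}[[\zeta_2/\zeta_1]]$ with constant term $1$ (it has eigenvalue $1$ and does not depend on $\alpha$). It is known from earlier work that for generic $s_1,s_2$ $$f_0(\zeta_1,\zeta_2)=(1-\zeta_2/\zeta_1)\sum_{k\ge0}\frac{(qt^{-1};q)_k(qt^{-1}s_1/s_2;q)_k}{(q;q)_k(qs_1/s_2;q)_k}(t\zeta_2/\zeta_1)^k .$$ *)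

theory Defs
  imports "HOL-Complex_Analysis.Complex_Analysis"
begin

definition qpoch_inf :: "complex \<Rightarrow> complex \<Rightarrow> complex" where
  "qpoch_inf a q = (\<Prod>k. 1 - a * q ^ k)"

definition theta_q :: "complex \<Rightarrow> complex \<Rightarrow> complex" where
  "theta_q q z = qpoch_inf z q * qpoch_inf (q / z) q * qpoch_inf q q"

text \<open>
  Throughout, \<open>rq\<close> and \<open>rt\<close> are the fixed square roots of \<open>q\<close> and \<open>t\<close>.
\<close>

definition h_fun :: "complex \<Rightarrow> complex \<Rightarrow> complex \<Rightarrow> complex" where
  "h_fun q t z = (1 - z) * (qpoch_inf (q / t * z) q / qpoch_inf (t * z) q)"

definition g_fun :: "complex \<Rightarrow> complex \<Rightarrow> complex \<Rightarrow> complex \<Rightarrow> complex" where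
  "g_fun q rq rt z = qpoch_inf (rq * rt * z) q / qpoch_inf (rq / rt * z) q"

text \<open>
  A formal power series \<open>F\<close> represents the element \<open>F(\<zeta>\<^sub>2/\<zeta>\<^sub>1)\<close> of \<open>\<complex>[[\<zeta>\<^sub>2/\<zeta>\<^sub>1]]\<close>.
  With \<open>\<xi>\<^sub>i = \<zeta>\<^sub>i u\<^sub>i\<close> and \<open>z = \<zeta>\<^sub>2/\<zeta>\<^sub>1\<close>, the product of the \<open>g\<close>-factors is
  \<open>g(\<xi>\<^sub>1/\<zeta>\<^sub>1) g(\<xi>\<^sub>2/\<zeta>\<^sub>1) g(\<zeta>\<^sub>2/\<xi>\<^sub>1) g(\<xi>\<^sub>2/\<zeta>\<^sub>2) = g(u\<^sub>1) g(u\<^sub>2 z) g(z/u\<^sub>1) g(u\<^sub>2)\<close>,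
  and \<open>f(\<xi>\<^sub>1, \<xi>\<^sub>2)\<close> becomes \<open>F(u\<^sub>2 z/u\<^sub>1)\<close>.  The factors involving \<open>z\<close> are expanded
  at \<open>z = 0\<close>.
\<close>

definition I_integrand ::
  "complex \<Rightarrow> complex \<Rightarrow> complex \<Rightarrow> complex \<Rightarrow> complex \<Rightarrow> complex \<Rightarrow>
   complex fps \<Rightarrow> complex \<Rightarrow> complex \<Rightarrow> complex fps" where
  "I_integrand q rq rt \<alpha> s1 s2 F u1 u2 =
     fps_const
       ((theta_q q (\<alpha> / s1 * (rq / rt) / u1) / theta_q q (rq / rt / u1)) *
        (theta_q q (\<alpha> / s2 * (rq / rt) / u2) / theta_q q (rq / rt / u2)) *
        g_fun q rq rt u1 * g_fun q rq rt u2) *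
     fps_compose (fps_expansion (g_fun q rq rt) 0) (fps_const u2 * fps_X) *
     fps_compose (fps_expansion (g_fun q rq rt) 0) (fps_const (1 / u1) * fps_X) *
     fps_compose F (fps_const (u2 / u1) * fps_X)"

definition I_prefactor ::
  "complex \<Rightarrow> complex \<Rightarrow> complex \<Rightarrow> complex \<Rightarrow> complex" where
  "I_prefactor q t \<alpha> s =
     qpoch_inf (q / t) q * qpoch_inf q q /
     (qpoch_inf (\<alpha> / s * (q / t)) q * qpoch_inf (s / \<alpha> * q) q)"

text \<open>
  The measure \<open>d\<xi>\<^sub>i/(2\<pi>\<i>\<xi>\<^sub>i)\<close> is \<open>du\<^sub>i/(2\<pi>\<i>u\<^sub>i)\<close>, and the integral is taken coefficientwise.
  Zeros of \<open>\<Theta>\<^sub>q(q\<^sup>1\<^sup>/\<^sup>2 t\<^sup>-\<^sup>1\<^sup>/\<^sup>2/u)\<close> on the unit circle are harmless: for \<open>|q/t| < 1\<close> they are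
  cancelled by zeros of \<open>g(u)\<close>, so the integrand has at most one (removable) exceptional
  point on each circle.
\<close>

definition I_op ::
  "complex \<Rightarrow> complex \<Rightarrow> complex \<Rightarrow> complex \<Rightarrow> complex \<Rightarrow> complex \<Rightarrow> complex \<Rightarrow>
   complex fps \<Rightarrow> complex fps" where
  "I_op q t rq rt \<alpha> s1 s2 F =
     fps_const (I_prefactor q t \<alpha> s1 * I_prefactor q t \<alpha> s2) *
     fps_expansion (h_fun q t) 0 *
     Abs_fps (\<lambda>n.
       1 / (2 * of_real pi * \<i>) * contour_integral (circlepath 0 1) (\<lambda>u1.
         1 / (2 * of_real pi * \<i>) * contour_integral (circlepath 0 1) (\<lambda>u2.
           fps_nth (I_integrand q rq rt \<alpha> s1 s2 F u1 u2) n / u2) / u1))"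

definition first_eigenfunction ::
  "complex \<Rightarrow> complex \<Rightarrow> complex \<Rightarrow> complex \<Rightarrow> complex \<Rightarrow> complex \<Rightarrow> complex \<Rightarrow>
   complex fps \<Rightarrow> bool" where
  "first_eigenfunction q t rq rt \<alpha> s1 s2 F \<longleftrightarrow>
     fps_nth F 0 = 1 \<and> (\<exists>c. I_op q t rq rt \<alpha> s1 s2 F = fps_const c * F)"

text \<open>
  Genericity of the parameters: the normalising factors have no poles, and the eigenvalue \<open>1\<close>
  of the constant term is simple.  The operator is triangular with respect to the monomials
  \<open>z\<^sup>k\<close>, so the latter says that no other diagonal entry equals \<open>1\<close>; without it the
  eigenfunction with constant term \<open>1\<close> need not be unique.  For \<open>(s\<^sub>1,s\<^sub>2) = (1,t)\<close> the
  condition excludes only countably many \<open>\<alpha>\<close>; for instance at \<open>\<alpha> = t\<close> all the diagonal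
  entries with \<open>k \<ge> 1\<close> vanish.
\<close>

definition generic_params ::
  "complex \<Rightarrow> complex \<Rightarrow> complex \<Rightarrow> complex \<Rightarrow> complex \<Rightarrow> complex \<Rightarrow> complex \<Rightarrow> bool" where
  "generic_params q t rq rt \<alpha> s1 s2 \<longleftrightarrow>
     \<alpha> \<noteq> 0 \<and> s1 \<noteq> 0 \<and> s2 \<noteq> 0 \<and>
     (\<forall>s\<in>{s1, s2}. qpoch_inf (\<alpha> / s * (q / t)) q \<noteq> 0 \<and> qpoch_inf (s / \<alpha> * q) q \<noteq> 0) \<and>
     (\<forall>k\<ge>1. fps_nth (I_op q t rq rt \<alpha> s1 s2 (fps_X ^ k)) k \<noteq> 1)"

end

theory Submission
  imports Defs
begin

text \<open>
  Put \<open>a = q\<^sup>1\<^sup>/\<^sup>2 t\<^sup>-\<^sup>1\<^sup>/\<^sup>2\<close> and \<open>b = \<alpha> / s\<close>.  On the unit circle the theta quotient times \<open>g(u)\<close> is the weight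
  \<open>(ba/u; q)\<^sub>\<infinity> (qu/(ba); q)\<^sub>\<infinity> / ((au; q)\<^sub>\<infinity> (a/u; q)\<^sub>\<infinity>)\<close>, and moving the contour from \<open>u\<close> to \<open>q u\<close>
  gives a two-term recursion for its moments.  The zeroth moment is the inverse of the
  prefactor: this is the normalisation in Ramanujan's summation of \<open>1\<psi>1\<close>, obtained from the
  growth rate of the moments.

  For \<open>(s\<^sub>1, s\<^sub>2) = (1, t)\<close> the claimed eigenfunction is \<open>h\<close> itself, so one needs that the
  integral of \<open>g(u\<^sub>2 z) g(z/u\<^sub>1) h(u\<^sub>2 z/u\<^sub>1)\<close> against the two weights does not depend on \<open>z\<close>.  Moving
  the contours to \<open>u\<^sub>1/q\<close> and \<open>q u\<^sub>2\<close> yields an identity between integrals that is free of \<open>\<alpha>\<close>; applied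
  to a suitable product of \<open>q\<close>-binomial series it shows that the coefficients \<open>p\<^sub>n\<close> of that integral satisfy
  \<open>(1 - q\<^sup>n) (t - q\<^sup>n) p\<^sub>n = (1 - q\<^sup>n\<^sup>-\<^sup>1) (1 - t q\<^sup>n\<^sup>-\<^sup>1) p\<^sub>n\<^sub>-\<^sub>1\<close>.  Hence \<open>p\<^sub>n = 0\<close> for \<open>n \<ge> 1\<close>, since
  \<open>|t| > |q|\<close>.  Uniqueness follows because the operator is triangular with no diagonal entry \<open>1\<close> beyond the first.
\<close>

section \<open>The infinite \<open>q\<close>-Pochhammer symbol\<close>

lemma convergent_prod_qpoch:
  assumes "norm q < 1"
  shows "convergent_prod (\<lambda>k. 1 - a * q ^ k :: complex)"
proof -
  have "summable (\<lambda>k. norm a * norm q ^ k)"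
    using assms by (intro summable_mult summable_geometric) auto
  hence "abs_convergent_prod (\<lambda>k. 1 - a * q ^ k)"
    by (intro summable_imp_abs_convergent_prod) (simp add: norm_mult norm_power)
  thus ?thesis by (rule abs_convergent_prod_imp_convergent_prod)
qed

lemma qpoch_inf_rec:
  assumes "norm q < 1"
  shows "qpoch_inf a q = (1 - a) * qpoch_inf (a * q) q"
  using has_prod_ignore_initial_segment'[OF convergent_prod_qpoch[OF assms, of a], of 1]
  unfolding qpoch_inf_def by (auto simp: has_prod_iff mult_ac)

lemma qpoch_inf_eq_0_iff:
  assumes "norm q < 1"
  shows "qpoch_inf a q = 0 \<longleftrightarrow> (\<exists>k. a * q ^ k = 1)"
proof
  assume "qpoch_inf a q = 0"
  thus "\<exists>k. a * q ^ k = 1"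
    using prodinf_nonzero[OF convergent_prod_qpoch[OF assms, of a]] unfolding qpoch_inf_def by fastforce
next
  assume "\<exists>k. a * q ^ k = 1"
  then obtain k where k: "a * q ^ k = 1" by blast
  have "(\<Prod>i<Suc k. 1 - a * q ^ i) = 0" using k by (intro prod_zero) auto
  thus "qpoch_inf a q = 0"
    using has_prod_ignore_initial_segment'[OF convergent_prod_qpoch[OF assms, of a], of "Suc k"]
    unfolding qpoch_inf_def by (auto simp: has_prod_iff)
qed

lemma qpoch_partial_LIMSEQ:
  assumes "norm q < 1"
  shows "(\<lambda>n. \<Prod>j<n. 1 - x * q ^ j) \<longlonglongrightarrow> qpoch_inf x q"
proof -
  have "(\<lambda>n. \<Prod>i\<le>n. 1 - x * q ^ i) \<longlonglongrightarrow> qpoch_inf x q"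
    unfolding qpoch_inf_def by (rule convergent_prod_LIMSEQ[OF convergent_prod_qpoch[OF assms]])
  thus ?thesis
    by (subst filterlim_sequentially_Suc[symmetric]) (simp add: lessThan_Suc_atMost)
qed

text \<open>The Weierstrass test on closed discs of radius 1 makes the partial products converge
  locally uniformly, so the limit is entire.\<close>

lemma holomorphic_qpoch_inf_UNIV:
  assumes "norm q < 1"
  shows "(\<lambda>z. qpoch_inf z q) holomorphic_on UNIV"
proof (rule holomorphic_uniform_sequence)
  show "(\<lambda>z. \<Prod>k<n. 1 - z * q ^ k) holomorphic_on UNIV" for n
    by (intro holomorphic_intros)
  fix x :: complex
  have "uniformly_convergent_on (cball x 1) (\<lambda>N z. \<Prod>k<N. 1 + (- (z * q ^ k)))"
  proof (rule uniformly_convergent_on_prod)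
    show "uniformly_convergent_on (cball x 1) (\<lambda>N z. \<Sum>n<N. norm (- (z * q ^ n)))"
    proof (rule Weierstrass_m_test')
      show "norm (norm (- (z * q ^ n))) \<le> (norm x + 1) * norm q ^ n" if "z \<in> cball x 1" for n z
      proof -
        have "norm z \<le> norm x + 1"
          using that norm_triangle_ineq2[of z x] by (simp add: dist_norm norm_minus_commute)
        thus ?thesis by (simp add: norm_mult norm_power mult_right_mono)
      qed
      show "summable (\<lambda>n. (norm x + 1) * norm q ^ n)"
        using assms by (intro summable_mult summable_geometric) auto
    qed
  qed (auto intro!: continuous_intros)
  hence "uniform_limit (cball x 1) (\<lambda>N z. \<Prod>k<N. 1 - z * q ^ k) (\<lambda>z. lim (\<lambda>N. \<Prod>k<N. 1 - z * q ^ k)) sequentially"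
    by (simp add: uniformly_convergent_uniform_limit_iff)
  moreover have "lim (\<lambda>N. \<Prod>k<N. 1 - z * q ^ k) = qpoch_inf z q" for z
    by (rule limI[OF qpoch_partial_LIMSEQ[OF assms]])
  ultimately show "\<exists>d>0. cball x d \<subseteq> UNIV \<and> uniform_limit (cball x d) (\<lambda>n z. \<Prod>k<n. 1 - z * q ^ k) (\<lambda>z. qpoch_inf z q) sequentially"
    by (intro exI[of _ 1]) auto
qed auto

lemma holomorphic_qpoch_inf [holomorphic_intros]:
  assumes "f holomorphic_on A" "norm q < 1"
  shows "(\<lambda>z. qpoch_inf (f z) q) holomorphic_on A"
  using holomorphic_on_compose_gen[OF assms(1) holomorphic_qpoch_inf_UNIV[OF assms(2)]]
  by (simp add: o_def)

lemma qpoch_inf_0 [simp]: "qpoch_inf 0 q = 1"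
  by (simp add: qpoch_inf_def)

lemma qpoch_inf_nonzero:
  assumes "norm q < 1" "norm a < 1"
  shows "qpoch_inf a q \<noteq> 0"
proof
  assume "qpoch_inf a q = 0"
  then obtain k where "a * q ^ k = 1" using qpoch_inf_eq_0_iff[OF assms(1)] by blast
  hence "norm a * norm q ^ k = 1" by (metis norm_mult norm_one norm_power)
  moreover have "norm a * norm q ^ k \<le> norm a * 1"
    using assms by (intro mult_left_mono power_le_one) auto
  ultimately show False using assms by simp
qed

text \<open>Quasi-periodicity of the theta function under \<open>y \<mapsto> y / q\<close>: one
  linear factor is gained and one lost, and \<open>1 - y / q = - (y / q) * (1 - q / y)\<close>. The
  constant factor \<open>qpoch_inf q q\<close> is left out.\<close>

lemma qpoch_inf_theta_shift:
  assumes "norm q < 1" "q \<noteq> 0" "y \<noteq> 0"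
  shows "qpoch_inf (y / q) q * qpoch_inf (q^2 / y) q = - (y / q) * (qpoch_inf y q * qpoch_inf (q / y) q)"
proof -
  have "qpoch_inf (y / q) q = (1 - y / q) * qpoch_inf y q"
    using qpoch_inf_rec[OF assms(1), of "y / q"] assms by simp
  moreover have "qpoch_inf (q / y) q = (1 - q / y) * qpoch_inf (q^2 / y) q"
    using qpoch_inf_rec[OF assms(1), of "q / y"] assms by (simp add: power2_eq_square)
  ultimately show ?thesis using assms by (simp only:) (simp add: field_simps)
qed

section \<open>Means over the unit circle\<close>

text \<open>A relation is used instead of a value because \<open>contour_integral\<close> is total:
  the relation carries integrability along, as linearity requires.\<close>

definition has_circle_mean :: "(complex \<Rightarrow> complex) \<Rightarrow> complex \<Rightarrow> bool" where
  "has_circle_mean f m \<longleftrightarrow> ((\<lambda>u. f u / u) has_contour_integral (2 * of_real pi * \<i> * m)) (circlepath 0 1)"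

lemma has_circle_mean_imp_eq:
  "has_circle_mean f m \<Longrightarrow> 1 / (2 * of_real pi * \<i>) * contour_integral (circlepath 0 1) (\<lambda>u. f u / u) = m"
  by (auto simp: has_circle_mean_def dest!: contour_integral_unique)

lemma has_circle_mean_unique:
  "has_circle_mean f m \<Longrightarrow> has_circle_mean f m' \<Longrightarrow> m = m'"
  using has_circle_mean_imp_eq by metis

lemma has_circle_mean_add:
  "has_circle_mean f m \<Longrightarrow> has_circle_mean g m' \<Longrightarrow> has_circle_mean (\<lambda>u. f u + g u) (m + m')"
  unfolding has_circle_mean_def
  by (drule (1) has_contour_integral_add) (simp add: add_divide_distrib algebra_simps)

lemma has_circle_mean_cmult:
  assumes "has_circle_mean f m"
  shows "has_circle_mean (\<lambda>u. c * f u) (c * m)"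
  using has_contour_integral_lmul[OF assms[unfolded has_circle_mean_def], of c]
  unfolding has_circle_mean_def by (simp add: mult_ac)

lemma has_circle_mean_diff:
  "has_circle_mean f m \<Longrightarrow> has_circle_mean g m' \<Longrightarrow> has_circle_mean (\<lambda>u. f u - g u) (m - m')"
  using has_circle_mean_add[of f m "\<lambda>u. (-1) * g u" "(-1) * m'"] has_circle_mean_cmult[of g m' "-1"]
  by simp

lemma has_circle_mean_0: "has_circle_mean (\<lambda>u. 0) 0"
  unfolding has_circle_mean_def using has_contour_integral_0 by simp

text \<open>The circle path is injective on the open parameter interval, so finitely many
  exceptional \<open>u\<close> have a finite preimage. This covers points where a denominator in the
  integrand vanishes and the quotient has the default value 0.\<close>

lemma has_circle_mean_spike:
  assumes "has_circle_mean f m" and "finite K" and "\<And>u. norm u = 1 \<Longrightarrow> u \<notin> K \<Longrightarrow> g u = f u"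
  shows "has_circle_mean g m"
proof -
  define S where "S = {x \<in> {0..1}. circlepath 0 1 x \<in> K}"
  have "inj_on (circlepath 0 1) {0<..<1}"
    using simple_path_circlepath[of 0 1]
    unfolding simple_path_def loop_free_def inj_on_def by fastforce
  hence "finite (S \<inter> {0<..<1})"
    by (intro finite_vimage_IntI[of K "circlepath 0 1" "{0<..<1}", THEN finite_subset[rotated]] assms)
       (auto simp: S_def)
  moreover have "S \<subseteq> insert 0 (insert 1 (S \<inter> {0<..<1}))"
    by (auto simp: S_def)
  ultimately have "finite S" by (meson finite_insert finite_subset)
  show ?thesis
    unfolding has_circle_mean_def has_contour_integral
  proof (rule has_integral_spike_finite[OF \<open>finite S\<close>])
    show "((\<lambda>x. f (circlepath 0 1 x) / circlepath 0 1 x * vector_derivative (circlepath 0 1) (at x)) has_integral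
           2 * complex_of_real pi * \<i> * m) {0..1}"
      using assms(1) unfolding has_circle_mean_def has_contour_integral .
  next
    fix x :: real assume x: "x \<in> {0..1} - S"
    have "norm (circlepath 0 1 x) = 1" by (simp add: circlepath norm_exp_eq_Re)
    with x assms(3) show "g (circlepath 0 1 x) / circlepath 0 1 x * vector_derivative (circlepath 0 1) (at x) =
         f (circlepath 0 1 x) / circlepath 0 1 x * vector_derivative (circlepath 0 1) (at x)"
      by (auto simp: S_def)
  qed
qed

lemma has_circle_mean_cong:
  assumes "has_circle_mean f m" and "\<And>u. norm u = 1 \<Longrightarrow> g u = f u"
  shows "has_circle_mean g m"
  using has_circle_mean_spike[OF assms(1) finite.emptyI] assms(2) by auto

lemma has_circle_mean_continuous:
  assumes "continuous_on (sphere 0 1) f"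
  shows "has_circle_mean f (1 / (2 * of_real pi * \<i>) * contour_integral (circlepath 0 1) (\<lambda>u. f u / u))"
proof -
  have "(\<lambda>u. f u / u) contour_integrable_on circlepath 0 1"
    by (rule contour_integrable_continuous_circlepath) (use assms in \<open>auto intro!: continuous_intros\<close>)
  thus ?thesis
    unfolding has_circle_mean_def by (simp add: has_contour_integral_integral)
qed

text \<open>Shrinking the circle to radius \<open>norm c\<close> does not change the integral, and
  \<open>du / u\<close> is invariant under \<open>u \<mapsto> c * u\<close>, so the deformation
  reads as a substitution in \<open>f\<close>.\<close>

lemma has_circle_mean_shift:
  assumes "has_circle_mean f m" and "f holomorphic_on A" and "open A"
    and "c \<noteq> 0" and "norm c \<le> 1"
    and sub: "\<And>u. norm c \<le> norm u \<Longrightarrow> norm u \<le> 1 \<Longrightarrow> u \<in> A"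
  shows "has_circle_mean (\<lambda>u. f (c * u)) m"
proof -
  define p where "p = (\<lambda>x. c * circlepath 0 1 x)"
  \<comment> \<open>The complex powers of \<open>c\<close> run from 1 to \<open>c\<close> with
    modulus \<open>norm c powr s\<close>, so every intermediate loop stays in the closed annulus
    between the two circles.\<close>
  define H where "H = (\<lambda>(s::real, x::real). exp (of_real s * Ln c) * circlepath 0 1 x)"
  have norm_H: "norm (H (s, x)) = norm c powr s" for s x
    using assms by (simp add: H_def norm_mult circlepath norm_exp_eq_Re powr_def)
  have hom: "homotopic_loops (A - {0}) (circlepath 0 1) p"
    unfolding homotopic_loops
  proof (intro exI[of _ H] conjI ballI)
    show "continuous_on ({0..1} \<times> {0..1}) H"
      unfolding H_def circlepath by (auto simp: case_prod_unfold intro!: continuous_intros)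
    show "H \<in> {0..1} \<times> {0..1} \<rightarrow> A - {0}"
    proof
      fix z :: "real \<times> real" assume z: "z \<in> {0..1} \<times> {0..1}"
      obtain s x where [simp]: "z = (s, x)" by force
      from z have s: "0 \<le> s" "s \<le> 1" by auto
      have "norm c powr s \<le> 1" using assms s by (auto intro!: powr_le1)
      moreover have "norm c powr 1 \<le> norm c powr s" using assms s by (intro powr_mono') auto
      ultimately have "H z \<in> A" using assms norm_H by (intro sub) auto
      thus "H z \<in> A - {0}" using norm_H[of s x] assms by auto
    qed
  qed (use assms in \<open>auto simp: H_def p_def pathfinish_def pathstart_def circlepath\<close>)
  have derp: "(p has_vector_derivative c * vector_derivative (circlepath 0 1) (at x)) (at x within X)" for x X
    unfolding p_def vector_derivative_circlepath
    by (rule has_vector_derivative_mult_right has_vector_derivative_circlepath)+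
  have vp: "valid_path p"
    unfolding valid_path_def
  proof (rule C1_differentiable_imp_piecewise)
    show "p C1_differentiable_on {0..1}"
      unfolding C1_differentiable_on_def
      by (intro exI[of _ "\<lambda>x. c * vector_derivative (circlepath 0 1) (at x)"] conjI ballI derp)
         (auto simp: vector_derivative_circlepath intro!: continuous_intros)
  qed
  have hol: "(\<lambda>u. f u / u) holomorphic_on A - {0}"
    by (intro holomorphic_intros holomorphic_on_subset[OF assms(2)]) auto
  have eq: "contour_integral (circlepath 0 1) (\<lambda>u. f u / u) = contour_integral p (\<lambda>u. f u / u)"
    by (rule Cauchy_theorem_homotopic_loops[OF hom _ hol _ vp]) (use assms in auto)
  have "path_image p \<subseteq> A - {0}"
    using homotopic_loops_imp_subset[OF hom] by simp
  hence "(\<lambda>u. f u / u) contour_integrable_on p"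
    by (intro contour_integrable_holomorphic_simple[OF hol _ vp]) (use assms in auto)
  hence "((\<lambda>u. f u / u) has_contour_integral 2 * of_real pi * \<i> * m) p"
    using eq assms(1) unfolding has_circle_mean_def
    by (metis contour_integral_unique has_contour_integral_integral)
  hence "((\<lambda>x. f (p x) / p x * vector_derivative p (at x)) has_integral 2 * of_real pi * \<i> * m) {0..1}"
    unfolding has_contour_integral .
  moreover have "vector_derivative p (at x) = c * vector_derivative (circlepath 0 1) (at x)" for x
    using derp by (rule vector_derivative_at)
  ultimately show ?thesis
    unfolding has_circle_mean_def has_contour_integral using assms by (simp add: p_def)
qed

lemma has_circle_mean_holomorphic:
  assumes "f holomorphic_on A" "open A" "cball 0 1 \<subseteq> A"
  shows "has_circle_mean f (f 0)"
proof -
  have "((\<lambda>u. f u / (u - 0)) has_contour_integral 2 * of_real pi * \<i> * f 0) (circlepath 0 1)"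
    by (rule Cauchy_integral_circlepath)
       (use assms ball_subset_cball[of 0 1] in
         \<open>force intro: holomorphic_on_subset[OF assms(1)] holomorphic_on_imp_continuous_on\<close>)+
  thus ?thesis by (simp add: has_circle_mean_def)
qed

section \<open>Moments of the theta weight\<close>

definition theta_weight :: "complex \<Rightarrow> complex \<Rightarrow> complex \<Rightarrow> complex \<Rightarrow> complex" where
  "theta_weight q a b u = qpoch_inf (b * a / u) q * qpoch_inf (q * u / (b * a)) q /
     (qpoch_inf (a * u) q * qpoch_inf (a / u) q)"

text \<open>
  \<open>(1 - a / u)\<close> times the weight; removing the pole at \<open>u = a\<close> leaves room for the shift \<open>u \<mapsto> q u\<close>.
\<close>

definition theta_weight_reg :: "complex \<Rightarrow> complex \<Rightarrow> complex \<Rightarrow> complex \<Rightarrow> complex" where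
  "theta_weight_reg q a b u = qpoch_inf (b * a / u) q * qpoch_inf (q * u / (b * a)) q /
     (qpoch_inf (a * u) q * qpoch_inf (a * q / u) q)"

definition moment :: "complex \<Rightarrow> complex \<Rightarrow> complex \<Rightarrow> int \<Rightarrow> complex" where
  "moment q a b n = 1 / (2 * of_real pi * \<i>) *
     contour_integral (circlepath 0 1) (\<lambda>u. u powi n * theta_weight q a b u / u)"

text \<open>Here \<open>a * u\<close> and \<open>a * q / u\<close> have norm below 1, so the
  denominator of \<open>theta_weight_reg\<close> has no zeros. For \<open>norm a < 1\<close> and
  \<open>0 < norm q < 1\<close> the set contains both circles \<open>norm u = 1\<close> and
  \<open>norm u = norm q\<close>.\<close>

definition annulus :: "complex \<Rightarrow> complex \<Rightarrow> complex set" where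
  "annulus q a = {u. norm (a * q) < norm u \<and> norm (a * u) < 1}"

context
  fixes q a b :: complex
  assumes q: "0 < norm q" "norm q < 1" and a: "0 < norm a" "norm a < 1" and b: "b \<noteq> 0"
begin

lemma open_annulus: "open (annulus q a)"
  unfolding annulus_def by (intro open_Collect_conj open_Collect_less continuous_intros)

lemma mem_annulus:
  assumes "norm a * norm q < norm u" "norm u \<le> 1"
  shows "u \<in> annulus q a"
proof -
  have "norm a * norm u \<le> norm a * 1"
    using assms by (intro mult_left_mono) auto
  hence "norm a * norm u < 1" using a by linarith
  thus ?thesis using assms by (simp add: annulus_def norm_mult)
qed

lemma theta_weight_reg_holomorphic [holomorphic_intros]:
  "theta_weight_reg q a b holomorphic_on annulus q a"
proof -
  have "qpoch_inf (a * u) q \<noteq> 0" "qpoch_inf (a * q / u) q \<noteq> 0" "u \<noteq> 0" if "u \<in> annulus q a" for u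
  proof -
    have u: "u \<noteq> 0" "norm (a * u) < 1" "norm (a * q) < norm u"
      using that by (auto simp: annulus_def)
    thus "qpoch_inf (a * u) q \<noteq> 0" "qpoch_inf (a * q / u) q \<noteq> 0" "u \<noteq> 0"
      using q qpoch_inf_nonzero[of q "a * u"] qpoch_inf_nonzero[of q "a * q / u"] by (auto simp: norm_divide)
  qed
  thus ?thesis unfolding theta_weight_reg_def[abs_def]
    using q a b by (intro holomorphic_intros) auto
qed

lemma theta_weight_reg_eq:
  assumes "norm a < norm u"
  shows "theta_weight_reg q a b u = (1 - a / u) * theta_weight q a b u"
proof -
  have "qpoch_inf (a / u) q = (1 - a / u) * qpoch_inf (a * q / u) q"
    using qpoch_inf_rec[OF q(2), of "a / u"] by simp
  moreover have "u \<noteq> 0" "a \<noteq> u" using assms by auto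
  ultimately show ?thesis
    unfolding theta_weight_reg_def theta_weight_def by simp
qed

text \<open>At \<open>q * u\<close> the missing denominator factor reappears, because
  \<open>a * q / (q * u) = a / u\<close>. The numerator changes by the theta shift, and
  \<open>qpoch_inf (a * u) q\<close> loses the factor \<open>1 - a * u\<close>.\<close>

lemma theta_weight_reg_q:
  assumes "norm u = 1"
  shows "theta_weight_reg q a b (q * u) = - (b * a / (q * u)) * (1 - a * u) * theta_weight q a b u"
proof -
  have u: "u \<noteq> 0" using assms by auto
  define y where "y = b * a / u"
  have y: "y \<noteq> 0" using u a b by (auto simp: y_def)
  have "norm (a * u) < 1" using assms a by (simp add: norm_mult)
  hence nz: "1 - a * u \<noteq> 0" by (metis less_irrefl norm_one right_minus_eq)
  have "qpoch_inf (a * u) q = (1 - a * u) * qpoch_inf (a * (q * u)) q"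
    using qpoch_inf_rec[OF q(2), of "a * u"] by (simp add: mult_ac)
  moreover have "qpoch_inf (b * a / (q * u)) q * qpoch_inf (q * (q * u) / (b * a)) q
      = - (y / q) * (qpoch_inf y q * qpoch_inf (q / y) q)"
    using qpoch_inf_theta_shift[OF q(2) _ y] q by (simp add: y_def power2_eq_square mult_ac)
  moreover have "a * q / (q * u) = a / u" "q / y = q * u / (b * a)" "y / q = b * a / (q * u)"
    using q by (auto simp: y_def)
  ultimately show ?thesis
    unfolding theta_weight_reg_def theta_weight_def using nz by (simp add: y_def mult_ac)
qed

lemma continuous_on_theta_weight: "continuous_on (sphere 0 1) (theta_weight q a b)"
proof -
  have "theta_weight q a b u = theta_weight_reg q a b u / (1 - a / u)" if "u \<in> sphere 0 1" for u
    using theta_weight_reg_eq[of u] that a by auto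
  moreover have "continuous_on (sphere 0 1) (\<lambda>u. theta_weight_reg q a b u / (1 - a / u))"
  proof (intro continuous_intros holomorphic_on_imp_continuous_on holomorphic_on_subset[OF theta_weight_reg_holomorphic])
    have "norm a * norm q < norm q" using a q by simp
    hence "norm a * norm q < 1" using q by linarith
    thus "sphere 0 1 \<subseteq> annulus q a" using mem_annulus by auto
  qed (use a in auto)
  ultimately show ?thesis by (subst continuous_on_cong[OF refl]) auto
qed

lemma has_circle_mean_moment:
  "has_circle_mean (\<lambda>u. u powi n * theta_weight q a b u) (moment q a b n)"
  unfolding moment_def
  by (intro has_circle_mean_continuous continuous_intros continuous_on_theta_weight) auto

lemma has_circle_mean_reg:
  "has_circle_mean (\<lambda>u. u powi n * theta_weight_reg q a b u) (moment q a b n - a * moment q a b (n - 1))"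
proof (rule has_circle_mean_cong)
  show "has_circle_mean (\<lambda>u. u powi n * theta_weight q a b u - a * (u powi (n - 1) * theta_weight q a b u))
     (moment q a b n - a * moment q a b (n - 1))"
    by (intro has_circle_mean_diff has_circle_mean_cmult has_circle_mean_moment)
  fix u :: complex assume u: "norm u = 1"
  hence "u \<noteq> 0" by auto
  with u a show "u powi n * theta_weight_reg q a b u = u powi n * theta_weight q a b u - a * (u powi (n - 1) * theta_weight q a b u)"
    by (subst theta_weight_reg_eq) (auto simp: power_int_diff field_simps)
qed

text \<open>Both sides are the mean of \<open>u powi n\<close> times the regularised weight: on the
  left over the unit circle, on the right over the circle of radius \<open>norm q\<close>.\<close>

lemma moment_rec:
  "moment q a b n - a * moment q a b (n - 1)
     = - b * a * q powi (n - 1) * (moment q a b (n - 1) - a * moment q a b n)"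
proof (rule has_circle_mean_unique)
  have hol: "(\<lambda>u. u powi n * theta_weight_reg q a b u) holomorphic_on annulus q a"
    by (intro holomorphic_intros) (auto simp: annulus_def)
  have *: "norm a * norm q < norm q" using a q by simp
  have "has_circle_mean (\<lambda>u. (q * u) powi n * theta_weight_reg q a b (q * u)) (moment q a b n - a * moment q a b (n - 1))"
    by (intro has_circle_mean_shift[OF has_circle_mean_reg hol open_annulus] mem_annulus less_le_trans[OF *]) (use q in auto)
  thus "has_circle_mean (\<lambda>u. - b * a * q powi (n - 1) *
          (u powi (n - 1) * theta_weight q a b u - a * (u powi n * theta_weight q a b u)))
      (moment q a b n - a * moment q a b (n - 1))"
  proof (rule has_circle_mean_cong)
    fix u :: complex assume u: "norm u = 1"
    hence "u \<noteq> 0" "q \<noteq> 0" using q by auto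
    thus "- b * a * q powi (n - 1) * (u powi (n - 1) * theta_weight q a b u - a * (u powi n * theta_weight q a b u))
        = (q * u) powi n * theta_weight_reg q a b (q * u)"
      unfolding theta_weight_reg_q[OF u] by (simp add: power_int_mult_distrib power_int_diff field_simps)
  qed
  show "has_circle_mean (\<lambda>u. - b * a * q powi (n - 1) *
          (u powi (n - 1) * theta_weight q a b u - a * (u powi n * theta_weight q a b u)))
      (- b * a * q powi (n - 1) * (moment q a b (n - 1) - a * moment q a b n))"
    by (intro has_circle_mean_diff has_circle_mean_cmult has_circle_mean_moment)
qed

text \<open>Moving the contour inside the pole at \<open>u = a\<close> splits off the residue term
  \<open>theta_weight_reg q a b a * a ^ n\<close>. What remains lives on a circle of radius below
  \<open>norm a\<close>, so it is of smaller order.\<close>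

lemma moment_tendsto: "(\<lambda>n. moment q a b (int n) / a ^ n) \<longlonglongrightarrow> theta_weight_reg q a b a"
proof -
  define F where "F = theta_weight_reg q a b"
  \<comment> \<open>The difference quotient of \<open>F\<close> at \<open>a\<close>, with the
    removable singularity filled in; it is the weight divided by \<open>u\<close>, minus its polar
    part at \<open>a\<close>.\<close>
  define D where "D = (\<lambda>u. if u = a then deriv F a else (F u - F a) / (u - a))"
  \<comment> \<open>Any radius strictly between \<open>norm (a * q)\<close> and
    \<open>norm a\<close> would do: it stays in the annulus and makes \<open>r / norm a\<close> less
    than 1.\<close>
  define r where "r = (norm (a * q) + norm a) / 2"
  define d where "d = (\<lambda>n. moment q a b (int n) - F a * a ^ n)"
  have "norm (a * q) < norm a" using a q by (simp add: norm_mult)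
  hence r: "norm (a * q) < r" "r < norm a" by (simp_all add: r_def)
  moreover have "0 \<le> norm (a * q)" by simp
  ultimately have r01: "0 < r" "r < 1" using a by linarith+
  have holD: "D holomorphic_on annulus q a"
    unfolding D_def F_def by (intro pole_lemma_open theta_weight_reg_holomorphic open_annulus)
  have mean_D: "has_circle_mean (\<lambda>u. u ^ Suc n * D u) (d n)" for n
  proof (rule has_circle_mean_cong)
    have "((\<lambda>u. u ^ n / (u - a)) has_contour_integral 2 * of_real pi * \<i> * a ^ n) (circlepath 0 1)"
      by (rule Cauchy_integral_circlepath) (use a in \<open>auto intro!: holomorphic_intros continuous_intros\<close>)
    hence "has_circle_mean (\<lambda>u. u ^ Suc n / (u - a)) (a ^ n)"
      unfolding has_circle_mean_def by (rule has_contour_integral_eq) auto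
    thus "has_circle_mean (\<lambda>u. u powi int n * theta_weight q a b u - F a * (u ^ Suc n / (u - a))) (d n)"
      unfolding d_def by (intro has_circle_mean_diff has_circle_mean_cmult has_circle_mean_moment)
    fix u :: complex assume "norm u = 1"
    with a have u: "u \<noteq> 0" "u \<noteq> a" "norm a < norm u" by auto
    have "F u = (1 - a / u) * theta_weight q a b u"
      unfolding F_def using u by (intro theta_weight_reg_eq)
    hence eq: "theta_weight q a b u = u * F u / (u - a)" using u by (simp add: field_simps)
    thus "u ^ Suc n * D u = u powi int n * theta_weight q a b u - F a * (u ^ Suc n / (u - a))"
      using u by (simp add: D_def eq diff_divide_distrib right_diff_distrib mult_ac)
  qed
  have "compact (D ` sphere 0 r)"
    using r r01 mem_annulus norm_mult[of a q]
    by (intro compact_continuous_image holomorphic_on_imp_continuous_on holomorphic_on_subset[OF holD]) auto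
  then obtain C where C: "\<And>u. norm u = r \<Longrightarrow> norm (D u) \<le> C"
    using compact_imp_bounded by (fastforce simp: bounded_iff)
  have "norm (D (of_real r)) \<le> C" using r01 by (intro C) auto
  hence C0: "0 \<le> C" using norm_ge_zero order_trans by blast
  have bound: "norm (d n) \<le> C * r ^ Suc n" for n
  proof -
    have hol: "(\<lambda>u. u ^ Suc n * D u) holomorphic_on annulus q a"
      by (intro holomorphic_intros holD)
    have "has_circle_mean (\<lambda>u. (of_real r * u) ^ Suc n * D (of_real r * u)) (d n)"
      by (rule has_circle_mean_shift[OF mean_D hol open_annulus])
         (use r r01 mem_annulus norm_mult[of a q] in auto)
    moreover have "norm ((of_real r * u) ^ Suc n * D (of_real r * u) / u) \<le> C * r ^ Suc n" if "norm u = 1" for u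
    proof -
      have "norm (D (of_real r * u)) \<le> C" using that r01 by (intro C) (simp add: norm_mult)
      moreover have "u \<noteq> 0" using that by auto
      ultimately show ?thesis using that r01
        by (simp add: norm_mult norm_divide norm_power mult_left_mono mult.commute[of _ C])
    qed
    ultimately have "norm (2 * of_real pi * \<i> * d n) \<le> C * r ^ Suc n * (2 * pi * 1)"
      unfolding has_circle_mean_def
      by (intro has_contour_integral_bound_circlepath) (use C0 r01 in auto)
    thus ?thesis by (simp add: norm_mult)
  qed
  have "(\<lambda>n. d n / a ^ n) \<longlonglongrightarrow> 0"
  proof (rule Lim_null_comparison)
    show "eventually (\<lambda>n. norm (d n / a ^ n) \<le> C * r * (r / norm a) ^ n) sequentially"
    proof (intro always_eventually allI)
      fix n
      have "norm (d n / a ^ n) \<le> (C * r ^ Suc n) / norm a ^ n"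
        unfolding norm_divide norm_power by (intro divide_right_mono bound) auto
      thus "norm (d n / a ^ n) \<le> C * r * (r / norm a) ^ n" by (simp add: power_divide mult_ac)
    qed
    have "(\<lambda>n. (r / norm a) ^ n) \<longlonglongrightarrow> 0" using r r01 a by (intro LIMSEQ_power_zero) auto
    thus "(\<lambda>n. C * r * (r / norm a) ^ n) \<longlonglongrightarrow> 0" by (rule tendsto_mult_right_zero)
  qed
  hence "(\<lambda>n. d n / a ^ n + F a) \<longlonglongrightarrow> 0 + F a" by (intro tendsto_intros)
  moreover have "d n / a ^ n + F a = moment q a b (int n) / a ^ n" for n
    using a by (simp add: d_def field_simps)
  ultimately show ?thesis by (simp add: F_def)
qed

lemma moment_Suc:
  "moment q a b (int (Suc n)) * (1 - b * a * a * q ^ n) = a * moment q a b (int n) * (1 - b * q ^ n)"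
  using moment_rec[of "int (Suc n)"] by (simp add: algebra_simps)

text \<open>Iteration of \<open>moment_Suc\<close>, kept free of division since a factor
  \<open>1 - b * a * a * q ^ j\<close> may vanish.\<close>

lemma moment_prod:
  "moment q a b (int n) * (\<Prod>j<n. 1 - b * a * a * q ^ j) = a ^ n * moment q a b 0 * (\<Prod>j<n. 1 - b * q ^ j)"
proof (induction n)
  case (Suc n)
  have "moment q a b (int (Suc n)) * (\<Prod>j<Suc n. 1 - b * a * a * q ^ j)
      = moment q a b (int (Suc n)) * (1 - b * a * a * q ^ n) * (\<Prod>j<n. 1 - b * a * a * q ^ j)"
    by (simp add: mult_ac)
  also have "\<dots> = a * (1 - b * q ^ n) * (moment q a b (int n) * (\<Prod>j<n. 1 - b * a * a * q ^ j))"
    unfolding moment_Suc by (simp add: mult_ac)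
  finally show ?case unfolding Suc.IH by (simp add: mult_ac)
qed auto

section \<open>Dependence of the zeroth moment on the parameter \<open>b\<close>\<close>

lemma theta_weight_mult_q:
  assumes "u \<noteq> 0"
  shows "theta_weight q a (q * b) u = - (u / (b * a)) * theta_weight q a b u"
proof -
  define y where "y = b * a / u"
  have y: "y \<noteq> 0" "q \<noteq> 0" using assms a b q by (auto simp: y_def)
  have "qpoch_inf y q * qpoch_inf (q / y) q = - y * (qpoch_inf (q * y) q * qpoch_inf (1 / y) q)"
    using qpoch_inf_theta_shift[OF q(2), of "q * y"] y by (simp add: power2_eq_square)
  hence "qpoch_inf (q * y) q * qpoch_inf (1 / y) q = - (1 / y) * (qpoch_inf y q * qpoch_inf (q / y) q)"
    using y by (simp add: field_simps)
  thus ?thesis unfolding theta_weight_def using y by (simp add: y_def mult_ac)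
qed

text \<open>Replacing \<open>b\<close> by \<open>q * b\<close> multiplies the weight by a constant
  times \<open>u\<close>, so the zeroth moment turns into the first, which \<open>moment_Suc\<close>
  reduces to the zeroth again.\<close>

lemma moment_mult_q:
  "moment q a (q * b) 0 * (1 - b * a * a) = (1 - 1 / b) * moment q a b 0"
proof -
  have "has_circle_mean (\<lambda>u. u powi 0 * theta_weight q a (q * b) u) (- (1 / (b * a)) * moment q a b 1)"
  proof (rule has_circle_mean_cong)
    show "has_circle_mean (\<lambda>u. - (1 / (b * a)) * (u powi 1 * theta_weight q a b u)) (- (1 / (b * a)) * moment q a b 1)"
      by (intro has_circle_mean_cmult has_circle_mean_moment)
    show "u powi 0 * theta_weight q a (q * b) u = - (1 / (b * a)) * (u powi 1 * theta_weight q a b u)"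
      if "norm u = 1" for u using theta_weight_mult_q[of u] that by force
  qed
  from has_circle_mean_imp_eq[OF this] have "moment q a (q * b) 0 = - (1 / (b * a)) * moment q a b 1"
    unfolding moment_def[of q a "q * b"] by simp
  moreover have "moment q a b 1 * (1 - b * a * a) = a * moment q a b 0 * (1 - b)"
    using moment_Suc[of 0] by simp
  ultimately have "moment q a (q * b) 0 * (1 - b * a * a) = - (1 / (b * a)) * (a * moment q a b 0 * (1 - b))"
    by (simp add: mult_ac)
  also have "\<dots> = (1 - 1 / b) * moment q a b 0" using a b by (simp add: field_simps)
  finally show ?thesis .
qed

text \<open>
  The two sides of the limit \<open>n \<rightarrow> \<infinity>\<close> of \<open>moment_prod\<close> share the factor \<open>qpoch_inf b q\<close>, hence the
  extra assumption.  The excluded values \<open>b = q\<^sup>-\<^sup>k\<close> are reached from \<open>b = 1\<close> by \<open>moment_mult_q\<close>.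
\<close>

lemma moment_0_regular:
  assumes "qpoch_inf b q \<noteq> 0"
  shows "moment q a b 0 * (qpoch_inf (a * a) q * qpoch_inf q q) = qpoch_inf (b * a * a) q * qpoch_inf (q / b) q"
proof -
  have "(\<lambda>n. moment q a b (int n) / a ^ n * (\<Prod>j<n. 1 - b * a * a * q ^ j)) \<longlonglongrightarrow>
      theta_weight_reg q a b a * qpoch_inf (b * a * a) q"
    by (intro tendsto_mult moment_tendsto qpoch_partial_LIMSEQ q)
  moreover have "moment q a b (int n) / a ^ n * (\<Prod>j<n. 1 - b * a * a * q ^ j)
      = moment q a b 0 * (\<Prod>j<n. 1 - b * q ^ j)" for n
    using moment_prod[of n] a by (simp add: field_simps)
  moreover have "(\<lambda>n. moment q a b 0 * (\<Prod>j<n. 1 - b * q ^ j)) \<longlonglongrightarrow> moment q a b 0 * qpoch_inf b q"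
    by (intro tendsto_mult tendsto_const qpoch_partial_LIMSEQ q)
  ultimately have "theta_weight_reg q a b a * qpoch_inf (b * a * a) q = moment q a b 0 * qpoch_inf b q"
    using LIMSEQ_unique by simp
  moreover have "theta_weight_reg q a b a = qpoch_inf b q * qpoch_inf (q / b) q / (qpoch_inf (a * a) q * qpoch_inf q q)"
    using a by (simp add: theta_weight_reg_def)
  moreover have "norm (a * a) < 1" using a mult_strict_mono'[of "norm a" 1 "norm a" 1] by (simp add: norm_mult)
  hence "qpoch_inf (a * a) q \<noteq> 0" "qpoch_inf q q \<noteq> 0"
    using q qpoch_inf_nonzero by blast+
  ultimately show ?thesis using assms by (simp add: field_simps)
qed

end

text \<open>For \<open>b = 1\<close> the factor \<open>qpoch_inf (a / u) q\<close> cancels. The rest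
  is holomorphic on the disc of radius \<open>1 / norm a\<close>, so its mean is its value at
  0.\<close>

lemma moment_0_one:
  assumes q: "0 < norm q" "norm q < 1" and a: "0 < norm a" "norm a < 1"
  shows "moment q a 1 0 = 1"
proof -
  have nz: "qpoch_inf (a * u) q \<noteq> 0" if "u \<in> ball 0 (1 / norm a)" for u
    using that a q by (intro qpoch_inf_nonzero) (auto simp: norm_mult field_simps)
  have "has_circle_mean (\<lambda>u. qpoch_inf (q * u / a) q / qpoch_inf (a * u) q) (qpoch_inf (q * 0 / a) q / qpoch_inf (a * 0) q)"
    by (rule has_circle_mean_holomorphic[where A = "ball 0 (1 / norm a)"])
       (use nz a q in \<open>auto intro!: holomorphic_intros simp: cball_subset_ball_iff\<close>)
  hence "has_circle_mean (\<lambda>u. qpoch_inf (q * u / a) q / qpoch_inf (a * u) q) 1" by simp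
  hence "has_circle_mean (\<lambda>u. u powi 0 * theta_weight q a 1 u) 1"
  proof (rule has_circle_mean_cong)
    fix u :: complex assume "norm u = 1"
    hence "qpoch_inf (a / u) q \<noteq> 0" using a q by (intro qpoch_inf_nonzero) (auto simp: norm_divide)
    thus "u powi 0 * theta_weight q a 1 u = qpoch_inf (q * u / a) q / qpoch_inf (a * u) q"
      by (simp add: theta_weight_def)
  qed
  from has_circle_mean_imp_eq[OF this] show ?thesis by (simp add: moment_def)
qed

lemma moment_0:
  assumes q: "0 < norm q" "norm q < 1" and a: "0 < norm a" "norm a < 1" and b: "b \<noteq> 0"
  shows "moment q a b 0 * (qpoch_inf (a * a) q * qpoch_inf q q) = qpoch_inf (b * a * a) q * qpoch_inf (q / b) q"
proof (cases "qpoch_inf b q = 0")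
  case False
  thus ?thesis using moment_0_regular[OF q a b] by blast
next
  case True
  then obtain k where "b * q ^ k = 1" using qpoch_inf_eq_0_iff[OF q(2)] by blast
  thus ?thesis using b
  proof (induction k arbitrary: b)
    case 0
    thus ?case using moment_0_one[OF q a] by simp
  next
    case (Suc k)
    have "q \<noteq> 0" using q by auto
    have "moment q a (q * b) 0 * (qpoch_inf (a * a) q * qpoch_inf q q) = qpoch_inf (q * b * a * a) q * qpoch_inf (q / (q * b)) q"
      by (rule Suc.IH) (use Suc.prems q in \<open>auto simp: mult_ac\<close>)
    hence "moment q a (q * b) 0 * (1 - b * a * a) * (qpoch_inf (a * a) q * qpoch_inf q q)
        = ((1 - b * a * a) * qpoch_inf (b * a * a * q) q) * qpoch_inf (1 / b) q"
      using \<open>q \<noteq> 0\<close> by (simp add: mult_ac)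
    also have "(1 - b * a * a) * qpoch_inf (b * a * a * q) q = qpoch_inf (b * a * a) q"
      using qpoch_inf_rec[OF q(2)] by metis
    also have "qpoch_inf (1 / b) q = (1 - 1 / b) * qpoch_inf (q / b) q"
      using qpoch_inf_rec[OF q(2), of "1 / b"] by simp
    finally have "(1 - 1 / b) * (moment q a b 0 * (qpoch_inf (a * a) q * qpoch_inf q q))
        = (1 - 1 / b) * (qpoch_inf (b * a * a) q * qpoch_inf (q / b) q)"
      unfolding moment_mult_q[OF q a \<open>b \<noteq> 0\<close>] by (simp add: mult_ac)
    \<comment> \<open>Here \<open>b * q ^ Suc k = 1\<close>, so \<open>b = 1\<close> would make a
      positive power of \<open>q\<close> equal to 1.\<close>
    moreover have "1 - 1 / b \<noteq> 0"
    proof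
      assume "1 - 1 / b = 0"
      hence "b = 1" using Suc.prems by (simp add: field_simps)
      hence "q ^ Suc k = 1" using Suc.prems by simp
      hence "norm q ^ Suc k = 1" by (metis norm_one norm_power)
      thus False using q power_Suc_less_one[of "norm q" k] by simp
    qed
    ultimately show ?case using mult_left_cancel by blast
  qed
qed

section \<open>Means over the torus\<close>

text \<open>
  The integrand is a function of \<open>p = 1 / u1\<close> and \<open>r = u2\<close>, in which the coefficients of
  the powers of \<open>z\<close> are polynomial.
\<close>

definition has_torus_mean ::
  "(complex \<Rightarrow> complex) \<Rightarrow> (complex \<Rightarrow> complex) \<Rightarrow> (complex \<Rightarrow> complex \<Rightarrow> complex) \<Rightarrow> complex \<Rightarrow> bool" where
  "has_torus_mean w1 w2 f m \<longleftrightarrow> (\<exists>J.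
     (\<forall>u1. norm u1 = 1 \<longrightarrow> has_circle_mean (\<lambda>u2. w2 u2 * f (1 / u1) u2) (J u1)) \<and>
     has_circle_mean (\<lambda>u1. w1 u1 * J u1) m)"

lemma has_torus_mean_add:
  assumes "has_torus_mean w1 w2 f m" "has_torus_mean w1 w2 g m'"
  shows "has_torus_mean w1 w2 (\<lambda>p r. f p r + g p r) (m + m')"
proof -
  from assms obtain J J' where
    J: "\<And>u1. norm u1 = 1 \<Longrightarrow> has_circle_mean (\<lambda>u2. w2 u2 * f (1 / u1) u2) (J u1)"
       "has_circle_mean (\<lambda>u1. w1 u1 * J u1) m" and
    J': "\<And>u1. norm u1 = 1 \<Longrightarrow> has_circle_mean (\<lambda>u2. w2 u2 * g (1 / u1) u2) (J' u1)"
       "has_circle_mean (\<lambda>u1. w1 u1 * J' u1) m'"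
    unfolding has_torus_mean_def by metis
  show ?thesis
    unfolding has_torus_mean_def
    using has_circle_mean_add[OF J(1) J'(1)] has_circle_mean_add[OF J(2) J'(2)]
    by (intro exI[of _ "\<lambda>u. J u + J' u"]) (simp add: distrib_left)
qed

lemma has_torus_mean_cmult:
  assumes "has_torus_mean w1 w2 f m"
  shows "has_torus_mean w1 w2 (\<lambda>p r. c * f p r) (c * m)"
proof -
  from assms obtain J where
    J: "\<And>u1. norm u1 = 1 \<Longrightarrow> has_circle_mean (\<lambda>u2. w2 u2 * f (1 / u1) u2) (J u1)"
       "has_circle_mean (\<lambda>u1. w1 u1 * J u1) m"
    unfolding has_torus_mean_def by metis
  show ?thesis
    unfolding has_torus_mean_def
    using has_circle_mean_cmult[OF J(1), of _ c] has_circle_mean_cmult[OF J(2), of c]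
    by (intro exI[of _ "\<lambda>u. c * J u"]) (simp add: mult_ac)
qed

lemma has_torus_mean_diff:
  assumes "has_torus_mean w1 w2 f m" "has_torus_mean w1 w2 g m'"
  shows "has_torus_mean w1 w2 (\<lambda>p r. f p r - g p r) (m - m')"
  using has_torus_mean_add[OF assms(1) has_torus_mean_cmult[OF assms(2), of "-1"]] by simp

lemma has_torus_mean_sum:
  assumes "\<And>i. i \<in> I \<Longrightarrow> has_torus_mean w1 w2 (f i) (m i)"
  shows "has_torus_mean w1 w2 (\<lambda>p r. \<Sum>i\<in>I. f i p r) (\<Sum>i\<in>I. m i)"
proof -
  have 0: "has_torus_mean w1 w2 (\<lambda>p r. 0) 0"
    unfolding has_torus_mean_def using has_circle_mean_0 by (intro exI[of _ "\<lambda>_. 0"]) simp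
  show ?thesis using assms
    by (induction I rule: infinite_finite_induct) (auto intro: 0 has_torus_mean_add)
qed

lemma has_torus_mean_prod:
  assumes "has_circle_mean (\<lambda>u. w1 u * f (1 / u)) m" "has_circle_mean (\<lambda>u. w2 u * g u) m'"
  shows "has_torus_mean w1 w2 (\<lambda>p r. f p * g r) (m * m')"
  unfolding has_torus_mean_def
proof (intro exI[of _ "\<lambda>u. f (1 / u) * m'"] conjI allI impI)
  show "has_circle_mean (\<lambda>u2. w2 u2 * (f (1 / u1) * g u2)) (f (1 / u1) * m')" for u1
    using has_circle_mean_cmult[OF assms(2), of "f (1 / u1)"] by (simp add: mult_ac)
  show "has_circle_mean (\<lambda>u1. w1 u1 * (f (1 / u1) * m')) (m * m')"
    using has_circle_mean_cmult[OF assms(1), of m'] by (simp add: mult_ac)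
qed

lemma has_torus_mean_unique:
  assumes "has_torus_mean w1 w2 f m" "has_torus_mean w1 w2 f m'"
  shows "m = m'"
proof -
  from assms obtain J J' where
    J: "\<And>u1. norm u1 = 1 \<Longrightarrow> has_circle_mean (\<lambda>u2. w2 u2 * f (1 / u1) u2) (J u1)"
       "has_circle_mean (\<lambda>u1. w1 u1 * J u1) m" and
    J': "\<And>u1. norm u1 = 1 \<Longrightarrow> has_circle_mean (\<lambda>u2. w2 u2 * f (1 / u1) u2) (J' u1)"
       "has_circle_mean (\<lambda>u1. w1 u1 * J' u1) m'"
    unfolding has_torus_mean_def by metis
  have "has_circle_mean (\<lambda>u1. w1 u1 * J u1) m'"
    by (rule has_circle_mean_cong[OF J'(2)]) (metis J(1) J'(1) has_circle_mean_unique)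
  thus ?thesis using J(2) has_circle_mean_unique by blast
qed

text \<open>Polynomials in \<open>p\<close> and \<open>r\<close>, generated by monomials and sums so
  that linear statements on torus means need checking on monomials only.\<close>

inductive bipoly :: "(complex \<Rightarrow> complex \<Rightarrow> complex) \<Rightarrow> bool" where
  bipoly_monom: "bipoly (\<lambda>p r. c * p ^ A * r ^ B)"
| bipoly_add: "bipoly f \<Longrightarrow> bipoly g \<Longrightarrow> bipoly (\<lambda>p r. f p r + g p r)"

lemma bipoly_sum: "(\<And>i. i \<in> I \<Longrightarrow> bipoly (f i)) \<Longrightarrow> bipoly (\<lambda>p r. \<Sum>i\<in>I. f i p r)"
  using bipoly_monom[of 0 0 0]
  by (induction I rule: infinite_finite_induct) (auto intro: bipoly_add)

lemma bipoly_mult: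
  assumes "bipoly f" "bipoly g"
  shows "bipoly (\<lambda>p r. f p r * g p r)"
  using assms
proof (induction rule: bipoly.induct)
  case (bipoly_monom c A B)
  from bipoly_monom(1) show ?case
  proof (induction rule: bipoly.induct)
    case (bipoly_monom d C D)
    show ?case using bipoly.bipoly_monom[of "c * d" "A + C" "B + D"]
      by (simp add: power_add mult_ac)
  next
    case (bipoly_add f g)
    thus ?case using bipoly.bipoly_add by (simp add: distrib_left)
  qed
next
  case (bipoly_add f g)
  thus ?case using bipoly.bipoly_add by (simp add: distrib_right)
qed

section \<open>Torus means for two weights with \<open>q * b2 = b1 * a\<^sup>2\<close>, which
  encodes \<open>s2 / s1 = t\<close>\<close>

context
  fixes q a b1 b2 :: complex
  assumes q: "0 < norm q" "norm q < 1" and a: "0 < norm a" "norm a < 1"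
    and b: "b1 \<noteq> 0" "b2 \<noteq> 0" "q * b2 = b1 * a\<^sup>2"
begin

abbreviation "tmean \<equiv> has_torus_mean (theta_weight q a b1) (theta_weight q a b2)"

lemma has_circle_mean_inv_power:
  "has_circle_mean (\<lambda>u. theta_weight q a b1 u * (1 / u) ^ A) (moment q a b1 (- int A))"
  using has_circle_mean_moment[OF q a b(1), of "- int A"]
  by (simp add: power_int_minus field_simps)

lemma has_circle_mean_power:
  "has_circle_mean (\<lambda>u. theta_weight q a b2 u * u ^ B) (moment q a b2 (int B))"
  using has_circle_mean_moment[OF q a b(2), of "int B"]
  by (simp add: mult_ac)

lemma tmean_monom:
  "tmean (\<lambda>p r. c * p ^ A * r ^ B) (c * (moment q a b1 (- int A) * moment q a b2 (int B)))"
  using has_torus_mean_cmult[OF has_torus_mean_prod[OF has_circle_mean_inv_power has_circle_mean_power], of c]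
  by (simp add: mult_ac)

lemma bipoly_imp_tmean: "bipoly f \<Longrightarrow> \<exists>m. tmean f m"
proof (induction rule: bipoly.induct)
  case (bipoly_monom c A B)
  show ?case using tmean_monom by blast
next
  case (bipoly_add f g)
  thus ?case using has_torus_mean_add by blast
qed

text \<open>On each circle \<open>moment_rec\<close> relates the combination with
  \<open>1 / a\<close> to the one with \<open>a\<close>. The first circle contributes
  \<open>q ^ A / b2\<close>, after using \<open>q * b2 = b1 * a\<^sup>2\<close>, and the second
  \<open>b2 * q ^ B\<close>, so \<open>b2\<close> cancels.\<close>

lemma moment_exchange:
  "(moment q a b1 (- int A) - 1 / a * moment q a b1 (- int (Suc A))) *
   (moment q a b2 (int B) - 1 / a * moment q a b2 (int (Suc B)))
   = q ^ (A + B) * ((moment q a b1 (- int A) - a * moment q a b1 (- int (Suc A))) *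
   (moment q a b2 (int B) - a * moment q a b2 (int (Suc B))))"
proof -
  have nz: "q \<noteq> 0" "a \<noteq> 0" using q a by auto
  define x1 y1 x2 y2 where
    "x1 = moment q a b1 (- int A) - 1 / a * moment q a b1 (- int (Suc A))" and
    "y1 = moment q a b1 (- int A) - a * moment q a b1 (- int (Suc A))" and
    "x2 = moment q a b2 (int B) - 1 / a * moment q a b2 (int (Suc B))" and
    "y2 = moment q a b2 (int B) - a * moment q a b2 (int (Suc B))"
  have eqA: "- int A - 1 = - int (Suc A)" by simp
  have "y1 = - b1 * a * q powi (- int (Suc A)) * (moment q a b1 (- int (Suc A)) - a * moment q a b1 (- int A))"
    unfolding y1_def using moment_rec[OF q a b(1), of "- int A"] unfolding eqA .
  also have "\<dots> = b1 * a\<^sup>2 * q powi (- int (Suc A)) * x1"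
    using nz unfolding x1_def by (simp add: field_simps power2_eq_square)
  also have "\<dots> = q * b2 * q powi (- int (Suc A)) * x1" using b(3) by simp
  also have "q powi (- int (Suc A)) = 1 / (q * q ^ A)"
    unfolding power_int_minus power_int_of_nat by (simp add: field_simps)
  finally have y1: "q ^ A * y1 = b2 * x1" using nz by (simp add: field_simps)
  have "moment q a b2 (int (Suc B)) - a * moment q a b2 (int B) = - b2 * a * q ^ B * y2"
    unfolding y2_def using moment_rec[OF q a b(2), of "int (Suc B)"] by simp
  moreover have "a * x2 = - (moment q a b2 (int (Suc B)) - a * moment q a b2 (int B))"
    using nz unfolding x2_def by (simp add: field_simps)
  ultimately have "a * x2 = a * (b2 * q ^ B * y2)" by (simp add: mult.assoc)
  hence x2: "x2 = b2 * q ^ B * y2" using nz mult_left_cancel by blast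
  have "x1 * x2 = (b2 * x1) * (q ^ B * y2)" unfolding x2 by simp
  also have "\<dots> = q ^ (A + B) * (y1 * y2)" unfolding y1[symmetric] by (simp add: power_add)
  finally show ?thesis unfolding x1_def y1_def x2_def y2_def .
qed

text \<open>With \<open>d = 1 / a\<close> and \<open>d = a\<close> this yields the two sides of
  \<open>moment_exchange\<close>.\<close>

lemma tmean_factor:
  "tmean (\<lambda>p r. (1 - d * p) * (1 - d * r) * (c * p ^ A * r ^ B))
     (c * ((moment q a b1 (- int A) - d * moment q a b1 (- int (Suc A))) *
       (moment q a b2 (int B) - d * moment q a b2 (int (Suc B)))))"
proof -
  have "has_circle_mean (\<lambda>u. theta_weight q a b1 u * (1 / u) ^ A - d * (theta_weight q a b1 u * (1 / u) ^ Suc A))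
      (moment q a b1 (- int A) - d * moment q a b1 (- int (Suc A)))"
    by (intro has_circle_mean_diff has_circle_mean_cmult has_circle_mean_inv_power)
  hence 1: "has_circle_mean (\<lambda>u. theta_weight q a b1 u * ((1 - d * (1 / u)) * (1 / u) ^ A))
      (moment q a b1 (- int A) - d * moment q a b1 (- int (Suc A)))"
    by (rule has_circle_mean_cong) (simp add: algebra_simps)
  have "has_circle_mean (\<lambda>u. theta_weight q a b2 u * u ^ B - d * (theta_weight q a b2 u * u ^ Suc B))
      (moment q a b2 (int B) - d * moment q a b2 (int (Suc B)))"
    by (intro has_circle_mean_diff has_circle_mean_cmult has_circle_mean_power)
  hence 2: "has_circle_mean (\<lambda>u. theta_weight q a b2 u * ((1 - d * u) * u ^ B))
      (moment q a b2 (int B) - d * moment q a b2 (int (Suc B)))"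
    by (rule has_circle_mean_cong) (simp add: algebra_simps)
  show ?thesis
    using has_torus_mean_cmult[OF has_torus_mean_prod[OF 1 2], of c] by (simp add: mult_ac)
qed

text \<open>
  The substitution \<open>u1 \<mapsto> u1 / q\<close>, \<open>u2 \<mapsto> q * u2\<close> multiplies the weights by factors that depend on \<open>b1\<close>
  and \<open>b2\<close> only through \<open>b1 / b2\<close>; this is where \<open>s2 / s1 = t\<close> enters.
\<close>

lemma tmean_exchange:
  assumes "bipoly f"
  shows "\<exists>m. tmean (\<lambda>p r. (1 - 1 / a * p) * (1 - 1 / a * r) * f p r) m \<and>
             tmean (\<lambda>p r. (1 - a * p) * (1 - a * r) * f (q * p) (q * r)) m"
  using assms
proof (induction rule: bipoly.induct)
  case (bipoly_monom c A B)
  have "tmean (\<lambda>p r. (1 - a * p) * (1 - a * r) * (c * q ^ (A + B) * p ^ A * r ^ B))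
     (c * q ^ (A + B) * ((moment q a b1 (- int A) - a * moment q a b1 (- int (Suc A))) *
       (moment q a b2 (int B) - a * moment q a b2 (int (Suc B)))))"
    by (rule tmean_factor)
  moreover have "c * q ^ (A + B) * p ^ A * r ^ B = c * (q * p) ^ A * (q * r) ^ B" for p r
    by (simp add: power_add power_mult_distrib)
  ultimately have "tmean (\<lambda>p r. (1 - a * p) * (1 - a * r) * (c * (q * p) ^ A * (q * r) ^ B))
     (c * (q ^ (A + B) * ((moment q a b1 (- int A) - a * moment q a b1 (- int (Suc A))) *
       (moment q a b2 (int B) - a * moment q a b2 (int (Suc B))))))"
    by (simp only: mult.assoc)
  thus ?case
    using tmean_factor[of "1 / a" c A B] unfolding moment_exchange by blast
next
  case (bipoly_add f g)
  then obtain m m' where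
    m: "tmean (\<lambda>p r. (1 - 1 / a * p) * (1 - 1 / a * r) * f p r) m"
       "tmean (\<lambda>p r. (1 - a * p) * (1 - a * r) * f (q * p) (q * r)) m" and
    m': "tmean (\<lambda>p r. (1 - 1 / a * p) * (1 - 1 / a * r) * g p r) m'"
       "tmean (\<lambda>p r. (1 - a * p) * (1 - a * r) * g (q * p) (q * r)) m'"
    by blast
  show ?case
    using has_torus_mean_add[OF m(1) m'(1)] has_torus_mean_add[OF m(2) m'(2)]
    unfolding distrib_left[symmetric] by blast
qed

end

section \<open>The functional equation of the kernel\<close>

text \<open>The coefficientwise form matches what \<open>fps_compose_linear\<close> makes of the
  compositions in \<open>I_integrand\<close>.\<close>

definition fps_scale :: "'a \<Rightarrow> 'a::comm_ring_1 fps \<Rightarrow> 'a fps" where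
  "fps_scale c F = Abs_fps (\<lambda>n. c ^ n * fps_nth F n)"

lemma fps_scale_nth [simp]: "fps_nth (fps_scale c F) n = c ^ n * fps_nth F n"
  by (simp add: fps_scale_def)

lemma fps_scale_mult: "fps_scale c (F * G) = fps_scale c F * fps_scale c G"
proof (rule fps_ext)
  fix n
  show "fps_nth (fps_scale c (F * G)) n = fps_nth (fps_scale c F * fps_scale c G) n"
    unfolding fps_mult_nth fps_scale_nth sum_distrib_left
    by (intro sum.cong) (auto simp: mult_ac simp flip: power_add)
qed

lemma fps_scale_scale [simp]: "fps_scale c (fps_scale d F) = fps_scale (c * d) F"
  by (rule fps_ext) (simp add: power_mult_distrib mult_ac)

lemma fps_scale_linear: "fps_scale c (1 - fps_const d * fps_X) = 1 - fps_const (d * c) * fps_X"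
  by (rule fps_ext) (auto simp: fps_X_def)

lemma fps_linear_factor_nonzero: "1 - fps_const d * fps_X \<noteq> (0 :: 'a::idom fps)"
proof
  assume "1 - fps_const d * fps_X = (0 :: 'a fps)"
  hence "fps_nth (1 - fps_const d * fps_X :: 'a fps) 0 = 0" by simp
  thus False by simp
qed

text \<open>In the application \<open>C\<close> expands
  \<open>qpoch_inf (t * z) q / qpoch_inf z q\<close>, and \<open>(1 - fps_X) * k\<close> is the
  series of \<open>h_fun\<close>. The product is then the \<open>z\<close>-dependent part of the
  integrand with \<open>F\<close> the series of \<open>h_fun\<close>, up to a rescaling of
  \<open>z\<close> by \<open>q\<close>.\<close>

definition kernel_prod :: "complex \<Rightarrow> complex fps \<Rightarrow> complex fps \<Rightarrow> complex \<Rightarrow> complex \<Rightarrow> complex fps" where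
  "kernel_prod t C k w1 w2 =
     fps_scale w1 C * fps_scale w2 C * fps_scale (t * w1 * w2) ((1 - fps_X) * k)"

text \<open>
  Found by matching, on the two sides of \<open>kernel_prod_telescopes\<close>, the residues in \<open>w1\<close> for
  fixed \<open>w1 * w2\<close>.
\<close>

definition telescoper :: "complex \<Rightarrow> complex fps \<Rightarrow> complex fps \<Rightarrow> complex \<Rightarrow> complex \<Rightarrow> complex fps" where
  "telescoper t C k w1 w2 =
     fps_const (t - 1) * fps_X * (1 - fps_const (t * w1 * w2) * fps_X\<^sup>2) *
     fps_scale w1 (C * inverse (1 - fps_const t * fps_X)) *
     fps_scale w2 (C * inverse (1 - fps_const t * fps_X)) *
     fps_scale (t * w1 * w2) k"

text \<open>
  The functional equation of the kernel after division by a common multiple of all the infinite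
  products, with \<open>z\<close> standing for the formal variable.
\<close>

lemma kernel_poly_identity:
  fixes q t w1 w2 z :: "'a::idom"
  defines "y \<equiv> w1 * w2 * z"
  shows "(t - z) * ((1 - t*w1*z) * (1 - t*q*w1*z)) * ((1 - t*w2*z) * (1 - t*q*w2*z))
            * ((1 - t*y) * (1 - q*y) * (1 - q^2*y))
       - (1 + t) * (1 - z) * ((1 - w1*z) * (1 - t*q*w1*z)) * ((1 - w2*z) * (1 - t*q*w2*z))
            * ((1 - q*t*y) * (1 - t^2*y) * (1 - q^2*y))
       + (1 - t*z) * ((1 - w1*z) * (1 - q*w1*z)) * ((1 - w2*z) * (1 - q*w2*z))
            * ((1 - q^2*t*y) * (1 - t^2*y) * (1 - t^2*q*y))
     = z * (t - 1) * ((1 - t*w1) * (1 - t*w2) * (1 - t*y*z) * (1 - t*q*w1*z) * (1 - t*q*w2*z) * ((1 - q*y) * (1 - q^2*y))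
        - (1 - q*w1) * (1 - q*w2) * (1 - q^2*t*y*z) * (1 - w1*z) * (1 - w2*z) * ((1 - t^2*y) * (1 - t^2*q*y)))"
  unfolding y_def by algebra

section \<open>Telescoping of the kernel, from first-order \<open>q\<close>-difference equations for
  \<open>C\<close> and \<open>k\<close>\<close>

context
  fixes q t :: complex and C k :: "complex fps"
  assumes t: "t \<noteq> 0"
    and C: "fps_scale q C * (1 - fps_const t * fps_X) = C * (1 - fps_X)"
    and k: "fps_scale q k * (1 - fps_const (q / t) * fps_X) = k * (1 - fps_const t * fps_X)"
begin

text \<open>Dividing \<open>C\<close> by \<open>1 - t z\<close> and \<open>1 - t q z\<close> leaves
  a series of which \<open>C(z)\<close>, \<open>C(q z)\<close> and \<open>C(q\<^sup>2 z)\<close> are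
  all polynomial multiples, by two uses of the difference equation.\<close>

lemma scaled_C:
  obtains B where
    "fps_scale w C = (1 - fps_const (t * w) * fps_X) * (1 - fps_const (t * q * w) * fps_X) * B"
    "fps_scale (q * w) C = (1 - fps_const w * fps_X) * (1 - fps_const (t * q * w) * fps_X) * B"
    "fps_scale (q\<^sup>2 * w) C = (1 - fps_const w * fps_X) * (1 - fps_const (q * w) * fps_X) * B"
    "fps_scale w (C * inverse (1 - fps_const t * fps_X)) = (1 - fps_const (t * q * w) * fps_X) * B"
    "fps_scale (q * w) (C * inverse (1 - fps_const t * fps_X)) = (1 - fps_const w * fps_X) * B"
proof -
  let ?l = "\<lambda>d. 1 - fps_const d * fps_X :: complex fps"
  have inv: "?l d * inverse (?l d) = 1" for d by (subst mult.commute, rule inverse_mult_eq_1) simp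
  define E where "E = C * inverse (?l t)"
  define B where "B = E * inverse (?l (t * q))"
  have CE: "C = ?l t * E" unfolding E_def using inv[of t] by (simp add: mult_ac)
  have EB: "E = ?l (t * q) * B" unfolding B_def using inv[of "t * q"] by (simp add: mult_ac)
  have C1: "fps_scale q C = ?l 1 * E"
    using C CE fps_linear_factor_nonzero[of t] by (simp add: mult_ac)
  have "fps_scale q C = ?l (t * q) * fps_scale q E"
    by (subst CE) (simp add: fps_scale_mult fps_scale_linear)
  hence E1: "fps_scale q E = ?l 1 * B"
    unfolding C1 using EB fps_linear_factor_nonzero[of "t * q"] by (simp add: mult_ac)
  have "fps_scale (q * q) C = ?l q * fps_scale q E"
    unfolding fps_scale_scale[symmetric] C1 by (simp only: fps_scale_mult fps_scale_linear mult_1)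
  hence C2: "fps_scale (q * q) C = ?l q * (?l 1 * B)" unfolding E1 .
  note sc = fps_scale_mult fps_scale_linear fps_scale_scale
  show thesis
  proof (rule that[of "fps_scale w B"])
    have "fps_scale w C = fps_scale w (?l t * (?l (t * q) * B))" using CE EB by simp
    thus "fps_scale w C = ?l (t * w) * ?l (t * q * w) * fps_scale w B"
      by (simp only: sc mult.assoc)
    have "fps_scale (w * q) C = fps_scale w (?l 1 * (?l (t * q) * B))"
      using C1 EB by (metis fps_scale_scale)
    thus "fps_scale (q * w) C = ?l w * ?l (t * q * w) * fps_scale w B"
      by (simp only: sc mult.assoc mult_1 mult.commute[of q w])
    have "fps_scale (w * (q * q)) C = fps_scale w (?l q * (?l 1 * B))"
      using C2 by (metis fps_scale_scale)
    thus "fps_scale (q\<^sup>2 * w) C = ?l w * ?l (q * w) * fps_scale w B"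
      by (simp only: sc mult_1) (simp add: mult_ac power2_eq_square)
    have "fps_scale w E = fps_scale w (?l (t * q) * B)" using EB by simp
    thus "fps_scale w (C * inverse (?l t)) = ?l (t * q * w) * fps_scale w B"
      unfolding E_def[symmetric] by (simp only: sc)
    have "fps_scale (w * q) E = fps_scale w (?l 1 * B)"
      using E1 by (metis fps_scale_scale)
    thus "fps_scale (q * w) (C * inverse (?l t)) = ?l w * fps_scale w B"
      unfolding E_def[symmetric] by (simp only: sc mult_1 mult.commute[of q w])
  qed
qed

text \<open>As for \<open>C\<close>, the common factor being \<open>k\<close> divided by
  \<open>1 - q z / t\<close> and \<open>1 - q\<^sup>2 z / t\<close>; the argument
  \<open>t * y\<close> clears the denominators \<open>t\<close>.\<close>

lemma scaled_k:
  obtains K where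
    "fps_scale (t * y) k = (1 - fps_const (q * y) * fps_X) * (1 - fps_const (q\<^sup>2 * y) * fps_X) * K"
    "fps_scale (q * (t * y)) k = (1 - fps_const (t\<^sup>2 * y) * fps_X) * (1 - fps_const (q\<^sup>2 * y) * fps_X) * K"
    "fps_scale (q\<^sup>2 * (t * y)) k = (1 - fps_const (t\<^sup>2 * y) * fps_X) * (1 - fps_const (t\<^sup>2 * q * y) * fps_X) * K"
proof -
  let ?l = "\<lambda>d. 1 - fps_const d * fps_X :: complex fps"
  have inv: "?l d * inverse (?l d) = 1" for d by (subst mult.commute, rule inverse_mult_eq_1) simp
  define K where "K = k * inverse (?l (q / t)) * inverse (?l (q\<^sup>2 / t))"
  have k0: "k = ?l (q / t) * (?l (q\<^sup>2 / t) * K)"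
  proof -
    have "?l (q / t) * (?l (q\<^sup>2 / t) * K) = k * (?l (q / t) * inverse (?l (q / t))) * (?l (q\<^sup>2 / t) * inverse (?l (q\<^sup>2 / t)))"
      unfolding K_def by (simp only: mult_ac)
    thus ?thesis unfolding inv by simp
  qed
  have "?l (q / t) * fps_scale q k = k * ?l t"
    using k by (simp only: mult.commute)
  also have "\<dots> = ?l (q / t) * (?l t * (?l (q\<^sup>2 / t) * K))"
    by (subst k0) (simp only: mult_ac)
  finally have "?l (q / t) * fps_scale q k = ?l (q / t) * (?l t * (?l (q\<^sup>2 / t) * K))" .
  hence k1: "fps_scale q k = ?l t * (?l (q\<^sup>2 / t) * K)"
    using fps_linear_factor_nonzero[of "q / t"] mult_left_cancel by blast
  have eq: "q / t * q = q\<^sup>2 / t" by (simp add: power2_eq_square)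
  have "fps_scale (q * q) k * ?l (q\<^sup>2 / t) = fps_scale q k * ?l (t * q)"
    using arg_cong[OF k, of "fps_scale q"]
    unfolding fps_scale_mult fps_scale_linear fps_scale_scale eq .
  also have "\<dots> = ?l t * (?l (t * q) * K) * ?l (q\<^sup>2 / t)"
    unfolding k1 by (simp only: mult_ac)
  finally have "?l (q\<^sup>2 / t) * fps_scale (q * q) k = ?l (q\<^sup>2 / t) * (?l t * (?l (t * q) * K))"
    by (simp only: mult.commute)
  hence k2: "fps_scale (q * q) k = ?l t * (?l (t * q) * K)"
    using fps_linear_factor_nonzero[of "q\<^sup>2 / t"] mult_left_cancel by blast
  note sc = fps_scale_mult fps_scale_linear
  show thesis
  proof (rule that[of "fps_scale (t * y) K"])
    have "fps_scale (t * y) k = fps_scale (t * y) (?l (q / t) * (?l (q\<^sup>2 / t) * K))" using k0 by simp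
    thus "fps_scale (t * y) k = ?l (q * y) * ?l (q\<^sup>2 * y) * fps_scale (t * y) K"
      unfolding sc using t by (simp add: mult_ac)
    have "fps_scale (t * y * q) k = fps_scale (t * y) (?l t * (?l (q\<^sup>2 / t) * K))"
      using k1 by (metis fps_scale_scale)
    thus "fps_scale (q * (t * y)) k = ?l (t\<^sup>2 * y) * ?l (q\<^sup>2 * y) * fps_scale (t * y) K"
      unfolding sc using t by (simp add: mult_ac power2_eq_square)
    have "fps_scale (t * y * (q * q)) k = fps_scale (t * y) (?l t * (?l (t * q) * K))"
      using k2 by (metis fps_scale_scale)
    thus "fps_scale (q\<^sup>2 * (t * y)) k = ?l (t\<^sup>2 * y) * ?l (t\<^sup>2 * q * y) * fps_scale (t * y) K"
      unfolding sc using t by (simp add: mult_ac power2_eq_square)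
  qed
qed

text \<open>Every term is a polynomial times the same series \<open>B1 * B2 * K\<close>, so a
  polynomial identity remains. The right-hand side is shaped so that \<open>tmean_exchange\<close>
  makes its mean vanish.\<close>

lemma kernel_prod_telescopes:
  "(fps_const t - fps_X) * kernel_prod t C k w1 w2
   - fps_const (1 + t) * (1 - fps_X) * fps_scale q (kernel_prod t C k w1 w2)
   + (1 - fps_const t * fps_X) * fps_scale (q\<^sup>2) (kernel_prod t C k w1 w2)
   = fps_const ((1 - t * w1) * (1 - t * w2)) * telescoper t C k w1 w2
     - fps_const ((1 - q * w1) * (1 - q * w2)) * telescoper t C k (q * w1) (q * w2)"
proof -
  let ?l = "\<lambda>d. 1 - fps_const d * fps_X :: complex fps"
  let ?E = "C * inverse (?l t)"
  obtain B1 where B1: "fps_scale w1 C = ?l (t * w1) * ?l (t * q * w1) * B1"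
    "fps_scale (q * w1) C = ?l w1 * ?l (t * q * w1) * B1"
    "fps_scale (q\<^sup>2 * w1) C = ?l w1 * ?l (q * w1) * B1"
    "fps_scale w1 ?E = ?l (t * q * w1) * B1" "fps_scale (q * w1) ?E = ?l w1 * B1"
    by (rule scaled_C)
  obtain B2 where B2: "fps_scale w2 C = ?l (t * w2) * ?l (t * q * w2) * B2"
    "fps_scale (q * w2) C = ?l w2 * ?l (t * q * w2) * B2"
    "fps_scale (q\<^sup>2 * w2) C = ?l w2 * ?l (q * w2) * B2"
    "fps_scale w2 ?E = ?l (t * q * w2) * B2" "fps_scale (q * w2) ?E = ?l w2 * B2"
    by (rule scaled_C)
  define y where "y = w1 * w2"
  obtain K where K: "fps_scale (t * y) k = ?l (q * y) * ?l (q\<^sup>2 * y) * K"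
    "fps_scale (q * (t * y)) k = ?l (t\<^sup>2 * y) * ?l (q\<^sup>2 * y) * K"
    "fps_scale (q\<^sup>2 * (t * y)) k = ?l (t\<^sup>2 * y) * ?l (t\<^sup>2 * q * y) * K"
    by (rule scaled_k)
  have h: "fps_scale s ((1 - fps_X) * k) = ?l s * fps_scale s k" for s
    using fps_scale_mult[of s "?l 1" k] fps_scale_linear[of s 1] by simp
  have P0: "kernel_prod t C k w1 w2 = fps_scale w1 C * fps_scale w2 C * (?l (t * y) * fps_scale (t * y) k)"
    unfolding kernel_prod_def h y_def by (simp add: mult.assoc)
  have P1: "fps_scale s (kernel_prod t C k w1 w2) = fps_scale (s * w1) C * fps_scale (s * w2) C * (?l (s * (t * y)) * fps_scale (s * (t * y)) k)" for s
    unfolding P0 fps_scale_mult fps_scale_linear fps_scale_scale by (simp add: mult_ac)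
  have T0: "telescoper t C k w1 w2 = fps_const (t - 1) * fps_X * (1 - fps_const (t * y) * fps_X\<^sup>2) *
      fps_scale w1 ?E * fps_scale w2 ?E * fps_scale (t * y) k"
    unfolding telescoper_def y_def by (simp add: mult.assoc)
  have y2: "t * (q * w1) * (q * w2) = q\<^sup>2 * (t * y)" by (simp add: y_def power2_eq_square mult_ac)
  have T1: "telescoper t C k (q * w1) (q * w2) = fps_const (t - 1) * fps_X * (1 - fps_const (q\<^sup>2 * (t * y)) * fps_X\<^sup>2) *
      fps_scale (q * w1) ?E * fps_scale (q * w2) ?E * fps_scale (q\<^sup>2 * (t * y)) k"
    unfolding telescoper_def y2 ..
  \<comment> \<open>The polynomial identity is used in the ring of formal power series itself, with
    the constants as ring elements and \<open>fps_X\<close> for its variable.\<close>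
  define qc tc v1 v2 z where defs: "qc = fps_const q" "tc = fps_const t" "v1 = fps_const w1" "v2 = fps_const w2" "z = (fps_X :: complex fps)"
  note conv = fps_const_mult[symmetric] fps_const_add[symmetric] fps_const_sub[symmetric] fps_const_power[symmetric] fps_const_1_eq_1
  have id: "(tc - z) * ((1 - tc * v1 * z) * (1 - tc * qc * v1 * z)) * ((1 - tc * v2 * z) * (1 - tc * qc * v2 * z))
            * ((1 - tc * (v1 * v2 * z)) * (1 - qc * (v1 * v2 * z)) * (1 - qc\<^sup>2 * (v1 * v2 * z)))
       - (1 + tc) * (1 - z) * ((1 - v1 * z) * (1 - tc * qc * v1 * z)) * ((1 - v2 * z) * (1 - tc * qc * v2 * z))
            * ((1 - qc * tc * (v1 * v2 * z)) * (1 - tc\<^sup>2 * (v1 * v2 * z)) * (1 - qc\<^sup>2 * (v1 * v2 * z)))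
       + (1 - tc * z) * ((1 - v1 * z) * (1 - qc * v1 * z)) * ((1 - v2 * z) * (1 - qc * v2 * z))
            * ((1 - qc\<^sup>2 * tc * (v1 * v2 * z)) * (1 - tc\<^sup>2 * (v1 * v2 * z)) * (1 - tc\<^sup>2 * qc * (v1 * v2 * z)))
     = z * (tc - 1) * ((1 - tc * v1) * (1 - tc * v2) * (1 - tc * (v1 * v2 * z) * z) * (1 - tc * qc * v1 * z) * (1 - tc * qc * v2 * z) * ((1 - qc * (v1 * v2 * z)) * (1 - qc\<^sup>2 * (v1 * v2 * z)))
        - (1 - qc * v1) * (1 - qc * v2) * (1 - qc\<^sup>2 * tc * (v1 * v2 * z) * z) * (1 - v1 * z) * (1 - v2 * z) * ((1 - tc\<^sup>2 * (v1 * v2 * z)) * (1 - tc\<^sup>2 * qc * (v1 * v2 * z))))"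
    (is "?L0 - ?L1 + ?L2 = z * (tc - 1) * (?R0 - ?R1)") by (rule kernel_poly_identity)
  have L0: "(fps_const t - fps_X) * kernel_prod t C k w1 w2 = ?L0 * (B1 * B2 * K)"
    unfolding P0 B1 B2 K unfolding y_def conv defs by (simp only: mult_ac)
  have L1: "fps_const (1 + t) * (1 - fps_X) * fps_scale q (kernel_prod t C k w1 w2) = ?L1 * (B1 * B2 * K)"
    unfolding P1 B1 B2 K unfolding y_def conv defs by (simp only: mult_ac)
  have L2: "(1 - fps_const t * fps_X) * fps_scale (q\<^sup>2) (kernel_prod t C k w1 w2) = ?L2 * (B1 * B2 * K)"
    unfolding P1 B1 B2 K unfolding y_def conv defs by (simp only: mult_ac)
  have R0: "fps_const ((1 - t * w1) * (1 - t * w2)) * telescoper t C k w1 w2 = z * (tc - 1) * ?R0 * (B1 * B2 * K)"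
    unfolding T0 B1 B2 K unfolding y_def conv defs by (simp only: mult_ac power2_eq_square)
  have R1: "fps_const ((1 - q * w1) * (1 - q * w2)) * telescoper t C k (q * w1) (q * w2) = z * (tc - 1) * ?R1 * (B1 * B2 * K)"
    unfolding T1 B1 B2 K unfolding y_def conv defs by (simp only: mult_ac power2_eq_square)
  have alg: "x0 - x1 + x2 = d * (y0 - y1) \<Longrightarrow> x0 * M - x1 * M + x2 * M = d * y0 * M - d * y1 * M"
    for x0 x1 x2 d y0 y1 M :: "complex fps"
    by algebra
  show ?thesis unfolding L0 L1 L2 R0 R1 by (rule alg[OF id])
qed

text \<open>Scaling by \<open>q\<close> multiplies the coefficient of \<open>z ^ n\<close> by
  \<open>q ^ n\<close>, so the three terms on the left combine:
  \<open>t - (1 + t) * x + x\<^sup>2 = (1 - x) * (t - x)\<close> and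
  \<open>1 - (1 + t) * x + t * x\<^sup>2 = (1 - x) * (1 - t * x)\<close>.\<close>

lemma kernel_prod_nth_telescopes:
  "(1 - q ^ Suc n) * (t - q ^ Suc n) * fps_nth (kernel_prod t C k w1 w2) (Suc n)
   - (1 - q ^ n) * (1 - t * q ^ n) * fps_nth (kernel_prod t C k w1 w2) n
   = (1 - t * w1) * (1 - t * w2) * fps_nth (telescoper t C k w1 w2) (Suc n)
     - (1 - q * w1) * (1 - q * w2) * fps_nth (telescoper t C k (q * w1) (q * w2)) (Suc n)"
  using arg_cong[OF kernel_prod_telescopes[of w1 w2], of "\<lambda>F. fps_nth F (Suc n)"]
  by (simp add: left_diff_distrib right_diff_distrib mult.assoc del: power_Suc)
     (simp add: algebra_simps power2_eq_square power_mult_distrib)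

end

section \<open>The integral operator\<close>

definition bipoly_fps :: "(complex \<Rightarrow> complex \<Rightarrow> complex fps) \<Rightarrow> bool" where
  "bipoly_fps F \<longleftrightarrow> (\<forall>n. bipoly (\<lambda>p r. fps_nth (F p r) n))"

lemma bipoly_fps_scale: "bipoly_fps (\<lambda>p r. fps_scale (c * p ^ A * r ^ B) F)"
  unfolding bipoly_fps_def
proof
  fix n
  show "bipoly (\<lambda>p r. fps_nth (fps_scale (c * p ^ A * r ^ B) F) n)"
    using bipoly_monom[of "c ^ n * fps_nth F n" "A * n" "B * n"]
    by (simp add: power_mult_distrib power_mult mult_ac)
qed

lemma bipoly_fps_mult:
  "bipoly_fps F \<Longrightarrow> bipoly_fps G \<Longrightarrow> bipoly_fps (\<lambda>p r. F p r * G p r)"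
  unfolding bipoly_fps_def fps_mult_nth by (intro allI bipoly_sum bipoly_mult) blast+

lemma bipoly_fps_linear: "bipoly_fps (\<lambda>p r. F + fps_const (c * p ^ A * r ^ B) * G)"
  unfolding bipoly_fps_def
proof
  fix n
  show "bipoly (\<lambda>p r. fps_nth (F + fps_const (c * p ^ A * r ^ B) * G) n)"
    using bipoly_add[OF bipoly_monom[of "fps_nth F n" 0 0] bipoly_monom[of "c * fps_nth G n" A B]]
    by (simp add: mult_ac)
qed

lemma bipoly_kernel_prod: "bipoly_fps (\<lambda>p r. kernel_prod t C k (d * p) (d * r))"
proof -
  have "bipoly_fps (\<lambda>p r. fps_scale (d * p ^ 1 * r ^ 0) C * fps_scale (d * p ^ 0 * r ^ 1) C *
      fps_scale (t * d * d * p ^ 1 * r ^ 1) ((1 - fps_X) * k))"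
    by (intro bipoly_fps_mult bipoly_fps_scale)
  thus ?thesis by (simp add: kernel_prod_def mult_ac)
qed

lemma bipoly_telescoper: "bipoly_fps (\<lambda>p r. telescoper t C k (d * p) (d * r))"
proof -
  let ?E = "C * inverse (1 - fps_const t * fps_X)"
  have eq: "1 + fps_const ((- t * d * d) * p ^ 1 * r ^ 1) * fps_X\<^sup>2 = 1 - fps_const (t * (d * p) * (d * r)) * fps_X\<^sup>2"
    for p r by (simp add: mult_ac flip: fps_const_neg)
  have "bipoly_fps (\<lambda>p r. (0 + fps_const ((t - 1) * p ^ 0 * r ^ 0) * fps_X) *
      (1 + fps_const ((- t * d * d) * p ^ 1 * r ^ 1) * fps_X\<^sup>2) *
      fps_scale (d * p ^ 1 * r ^ 0) ?E * fps_scale (d * p ^ 0 * r ^ 1) ?E *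
      fps_scale (t * d * d * p ^ 1 * r ^ 1) k)"
    by (intro bipoly_fps_mult bipoly_fps_scale bipoly_fps_linear)
  thus ?thesis unfolding eq by (simp add: telescoper_def mult_ac)
qed

text \<open>Taking means removes the telescoping terms and leaves a first-order recursion in
  \<open>n\<close>.\<close>

lemma tmean_kernel_prod:
  fixes q a b1 b2 t :: complex
  assumes q: "0 < norm q" "norm q < 1" and a: "0 < norm a" "norm a < 1"
    and b: "b1 \<noteq> 0" "b2 \<noteq> 0" "q * b2 = b1 * a\<^sup>2"
    and t: "t \<noteq> 0" "a\<^sup>2 = q / t"
    and C: "fps_scale q C * (1 - fps_const t * fps_X) = C * (1 - fps_X)"
    and k: "fps_scale q k * (1 - fps_const (q / t) * fps_X) = k * (1 - fps_const t * fps_X)"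
    and nth_0: "fps_nth C 0 = 1" "fps_nth k 0 = 1"
  shows "has_torus_mean (theta_weight q a b1) (theta_weight q a b2)
     (\<lambda>p r. fps_nth (kernel_prod t C k (a / q * p) (a / q * r)) n)
     (if n = 0 then moment q a b1 0 * moment q a b2 0 else 0)"
proof -
  let ?T = "has_torus_mean (theta_weight q a b1) (theta_weight q a b2)"
  let ?P = "\<lambda>n p r. fps_nth (kernel_prod t C k (a / q * p) (a / q * r)) n"
  have nz: "q \<noteq> 0" "a \<noteq> 0" using q a by auto
  \<comment> \<open>This explains the arguments \<open>a / q * p\<close> and
    \<open>a / q * r\<close>: multiplied by \<open>t\<close> they become \<open>p / a\<close> and
    \<open>r / a\<close>, multiplied by \<open>q\<close> they become \<open>a * p\<close> and
    \<open>a * r\<close>, the quantities in \<open>tmean_exchange\<close>.\<close>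
  have ta: "t * (a / q) = 1 / a" using nz t by (simp add: field_simps power2_eq_square)
  have "\<forall>n. \<exists>m. ?T (?P n) m"
    using bipoly_kernel_prod bipoly_imp_tmean[OF q a b] unfolding bipoly_fps_def by blast
  then obtain m where m: "\<And>n. ?T (?P n) (m n)" by metis
  have rec: "(1 - q ^ Suc n) * (t - q ^ Suc n) * m (Suc n) = (1 - q ^ n) * (1 - t * q ^ n) * m n" for n
  proof -
    let ?R = "\<lambda>p r. fps_nth (telescoper t C k (a / q * p) (a / q * r)) (Suc n)"
    have "bipoly ?R" using bipoly_telescoper unfolding bipoly_fps_def by blast
    from tmean_exchange[OF q a b this] obtain l where
      "?T (\<lambda>p r. (1 - 1 / a * p) * (1 - 1 / a * r) * ?R p r) l"
      "?T (\<lambda>p r. (1 - a * p) * (1 - a * r) * ?R (q * p) (q * r)) l" by blast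
    from has_torus_mean_diff[OF this]
    have "?T (\<lambda>p r. (1 - 1 / a * p) * (1 - 1 / a * r) * ?R p r
        - (1 - a * p) * (1 - a * r) * ?R (q * p) (q * r)) 0" by simp
    moreover have "(1 - 1 / a * p) * (1 - 1 / a * r) * ?R p r
        - (1 - a * p) * (1 - a * r) * ?R (q * p) (q * r)
       = (1 - q ^ Suc n) * (t - q ^ Suc n) * ?P (Suc n) p r - (1 - q ^ n) * (1 - t * q ^ n) * ?P n p r" for p r
    proof -
      have "t * (a / q * x) = 1 / a * x" for x unfolding ta[symmetric] by (simp only: mult.assoc)
      moreover have "q * (a / q * x) = a * x" "a / q * (q * x) = a * x" for x
        using nz by simp_all
      ultimately show ?thesis
        using kernel_prod_nth_telescopes[OF t(1) C k, of n "a / q * p" "a / q * r"] by metis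
    qed
    ultimately have "?T (\<lambda>p r. (1 - q ^ Suc n) * (t - q ^ Suc n) * ?P (Suc n) p r
        - (1 - q ^ n) * (1 - t * q ^ n) * ?P n p r) 0" by simp
    moreover have "?T (\<lambda>p r. (1 - q ^ Suc n) * (t - q ^ Suc n) * ?P (Suc n) p r
        - (1 - q ^ n) * (1 - t * q ^ n) * ?P n p r)
        ((1 - q ^ Suc n) * (t - q ^ Suc n) * m (Suc n) - (1 - q ^ n) * (1 - t * q ^ n) * m n)"
      by (intro has_torus_mean_diff has_torus_mean_cmult m)
    ultimately show ?thesis using has_torus_mean_unique by fastforce
  qed
  \<comment> \<open>\<open>norm a < 1\<close> means \<open>norm q < norm t\<close>, so no positive
    power of \<open>q\<close> equals \<open>t\<close>.\<close>
  have nonzero: "(1 - q ^ Suc n) * (t - q ^ Suc n) \<noteq> 0" for n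
  proof -
    have lt: "norm (q ^ Suc n) \<le> norm q"
      using q mult_left_le[of "norm q ^ n" "norm q"] by (simp add: norm_mult norm_power power_le_one)
    have "norm a * norm a < 1" using a mult_strict_mono'[of "norm a" 1 "norm a" 1] by simp
    hence "norm (q / t) < 1" unfolding t(2)[symmetric] by (simp add: norm_mult norm_power power2_eq_square)
    hence "norm q < norm t" using t(1) by (simp add: norm_divide field_simps)
    with lt q have "q ^ Suc n \<noteq> t" "q ^ Suc n \<noteq> 1" by auto
    thus ?thesis by auto
  qed
  have "m (Suc n) = 0" for n
  proof (induction n)
    \<comment> \<open>The factor \<open>1 - q ^ 0\<close> on the right vanishes, so
      \<open>m 1 = 0\<close> whatever \<open>m 0\<close> is.\<close>
    case 0
    show ?case using rec[of 0] nonzero[of 0] by simp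
  next
    case (Suc n)
    show ?case using rec[of "Suc n"] nonzero[of "Suc n"] Suc.IH by (metis mult_eq_0_iff)
  qed
  moreover have "m 0 = moment q a b1 0 * moment q a b2 0"
  proof -
    have "?P 0 p r = 1 * p ^ 0 * r ^ 0" for p r by (simp add: kernel_prod_def nth_0)
    thus ?thesis using m[of 0] tmean_monom[OF q a b, of 1 0 0] has_torus_mean_unique by fastforce
  qed
  ultimately show ?thesis using m[of n] by (cases n) simp_all
qed

text \<open>The recursion of the \<open>q\<close>-Pochhammer symbol gives
  \<open>f (q * z) * (1 - A * z) = f z * (1 - B * z)\<close> near 0, and uniqueness of expansions
  transfers this to the series. It supplies the difference equations for both \<open>C\<close> and
  \<open>k\<close>.\<close>

lemma qpoch_quotient_fps:
  fixes A B q :: complex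
  assumes q: "norm q < 1"
  defines "f \<equiv> (\<lambda>z. qpoch_inf (A * z) q / qpoch_inf (B * z) q)"
  defines "F \<equiv> fps_expansion f 0"
  shows qpoch_quotient_has_fps_expansion: "f has_fps_expansion F"
    and fps_nth_qpoch_quotient_0: "fps_nth F 0 = 1"
    and qpoch_quotient_fps_scale: "fps_scale q F * (1 - fps_const A * fps_X) = F * (1 - fps_const B * fps_X)"
proof -
  define S where "S = {z. norm (B * z) < 1}"
  have S: "open S" "0 \<in> S"
    unfolding S_def by (auto intro!: open_Collect_less continuous_intros)
  have nz: "qpoch_inf (B * z) q \<noteq> 0" if "z \<in> S" for z
    using that qpoch_inf_nonzero[OF q, of "B * z"] by (simp add: S_def)
  have "f holomorphic_on S"
    unfolding f_def
    by (intro holomorphic_on_divide holomorphic_qpoch_inf holomorphic_intros q nz) assumption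
  thus fF: "f has_fps_expansion F"
    unfolding F_def using S by (intro analytic_at_imp_has_fps_expansion_0) (auto simp: analytic_at)
  show "fps_nth F 0 = 1"
    using has_fps_expansion_imp_0_eq_fps_nth_0[OF fF] by (simp add: f_def)
  have "(f \<circ> (\<lambda>z. q * z)) has_fps_expansion fps_compose F (fps_const q * fps_X)"
    by (intro has_fps_expansion_compose fF fps_expansion_intros) auto
  hence lhs: "(\<lambda>z. f (q * z) * (1 - A * z)) has_fps_expansion fps_scale q F * (1 - fps_const A * fps_X)"
    unfolding fps_compose_linear fps_scale_def[symmetric] o_def by (intro fps_expansion_intros)
  have rhs: "(\<lambda>z. f z * (1 - B * z)) has_fps_expansion F * (1 - fps_const B * fps_X)"
    by (intro fps_expansion_intros fF)
  have "eventually (\<lambda>z. f (q * z) * (1 - A * z) = f z * (1 - B * z)) (nhds 0)"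
    using eventually_nhds_in_open[OF S]
  proof eventually_elim
    case (elim z)
    have nz: "1 - B * z \<noteq> 0" using elim by (auto simp: S_def)
    have eq: "qpoch_inf (c * z) q = (1 - c * z) * qpoch_inf (c * (q * z)) q" for c
      using qpoch_inf_rec[OF q, of "c * z"] by (simp add: mult_ac)
    show ?case
      unfolding f_def eq[of A] eq[of B] using nz by simp
  qed
  from has_fps_expansion_cong[OF this refl] lhs
  have "(\<lambda>z. f z * (1 - B * z)) has_fps_expansion fps_scale q F * (1 - fps_const A * fps_X)"
    by (rule iffD1)
  thus "fps_scale q F * (1 - fps_const A * fps_X) = F * (1 - fps_const B * fps_X)"
    using rhs by (rule fps_expansion_unique_complex)
qed

section \<open>Normalisation, and reduction of the integrand to the theta weight\<close>

lemma prefactor_times_moment: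
  assumes q: "0 < norm q" "norm q < 1" and a: "0 < norm a" "norm a < 1" "a\<^sup>2 = q / t"
    and "\<alpha> \<noteq> 0" "s \<noteq> 0"
    and nz: "qpoch_inf (\<alpha> / s * (q / t)) q \<noteq> 0" "qpoch_inf (s / \<alpha> * q) q \<noteq> 0"
  shows "I_prefactor q t \<alpha> s * moment q a (\<alpha> / s) 0 = 1"
proof -
  have eq: "\<alpha> / s * a * a = \<alpha> / s * (q / t)" "q / (\<alpha> / s) = s / \<alpha> * q" "a * a = q / t"
    unfolding a(3)[symmetric] by (simp_all add: power2_eq_square)
  show ?thesis
    using moment_0[OF q a(1,2), of "\<alpha> / s"] assms unfolding I_prefactor_def eq
    by (simp add: field_simps)
qed

text \<open>Since \<open>rq * rt = q / a\<close>, the numerator of \<open>g_fun\<close> is a factor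
  of the theta function in the denominator and cancels wherever it is nonzero.\<close>

lemma theta_ratio_eq_theta_weight:
  assumes q: "0 < norm q" "norm q < 1" and "a = rq / rt" "a \<noteq> 0" "rq * rt = q / a"
    and u: "norm u = 1" "qpoch_inf (q * u / a) q \<noteq> 0" and "\<alpha> \<noteq> 0" "s \<noteq> 0"
  shows "theta_q q (\<alpha> / s * (rq / rt) / u) / theta_q q (rq / rt / u) * g_fun q rq rt u = theta_weight q a (\<alpha> / s) u"
proof -
  have "u \<noteq> 0" using u by auto
  moreover have "qpoch_inf q q \<noteq> 0" using q by (intro qpoch_inf_nonzero)
  ultimately show ?thesis
    unfolding theta_q_def g_fun_def theta_weight_def assms(3)[symmetric] assms(5)
    using u assms(4,8,9) by (simp add: field_simps)
qed

text \<open>A zero satisfies \<open>q ^ Suc j * u = a\<close>; on the unit circle the norm of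
  \<open>a\<close> determines \<open>j\<close> and hence \<open>u\<close>, so there is at most
  one.\<close>

lemma finite_qpoch_zeros_on_circle:
  assumes q: "0 < norm q" "norm q < 1" and "a \<noteq> 0"
  shows "finite {u. norm u = 1 \<and> qpoch_inf (q * u / a) q = 0}" (is "finite ?K")
proof -
  have "u = v" if "u \<in> ?K" "v \<in> ?K" for u v
  proof -
    have "qpoch_inf (q * u / a) q = 0" "qpoch_inf (q * v / a) q = 0" using that by blast+
    then obtain j l where jl: "q * u / a * q ^ j = 1" "q * v / a * q ^ l = 1"
      unfolding qpoch_inf_eq_0_iff[OF q(2)] by blast
    hence eq: "q ^ Suc j * u = a" "q ^ Suc l * v = a" using assms by (auto simp: field_simps)
    have "norm u = 1" "norm v = 1" using that by blast+
    hence "norm q ^ Suc j = norm a" "norm q ^ Suc l = norm a"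
      using arg_cong[OF eq(1), of norm] arg_cong[OF eq(2), of norm] by (simp_all add: norm_mult norm_power)
    hence "norm q ^ Suc j = norm q ^ Suc l" by simp
    hence "Suc j = Suc l"
      using power_strict_decreasing[OF _ q] by (metis less_irrefl linorder_neqE_nat)
    hence "j = l" by simp
    thus "u = v" using eq q by auto
  qed
  hence "?K \<subseteq> {u}" if "u \<in> ?K" for u using that by blast
  thus ?thesis by (metis (no_types, lifting) ex_in_conv finite.emptyI finite_insert finite_subset)
qed


lemma sqrt_ratio:
  fixes q t rq rt :: complex
  assumes q: "0 < norm q" and t: "t \<noteq> 0" "norm (q / t) < 1" and r: "rq\<^sup>2 = q" "rt\<^sup>2 = t"
  defines "a \<equiv> rq / rt"
  shows "a \<noteq> 0" "norm a < 1" "a\<^sup>2 = q / t" "rq * rt = q / a" "rq * rt = t * a"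
proof -
  have r0: "rq \<noteq> 0" "rt \<noteq> 0" using q t r by auto
  thus "a \<noteq> 0" by (simp add: a_def)
  show a2: "a\<^sup>2 = q / t" using r by (simp add: a_def power_divide)
  have "norm a ^ 2 < 1" using t(2) unfolding a2[symmetric] by (simp add: norm_power)
  thus "norm a < 1" by (simp add: power_less_one_iff)
  show "rq * rt = q / a" "rq * rt = t * a"
    using r r0 unfolding a_def r[symmetric] by (simp_all add: field_simps power2_eq_square)
qed

text \<open>Off the finite set \<open>K\<close> the weights in \<open>I_op\<close> agree with
  \<open>theta_weight\<close>, so the iterated integral is a torus mean, and the factor depending on
  \<open>u1\<close> alone comes out of the inner integral.\<close>

lemma I_op_eq:
  fixes q t rq rt \<alpha> s1 s2 a :: complex and F :: "complex fps"
  assumes q: "0 < norm q" "norm q < 1" and a: "a = rq / rt" "a \<noteq> 0" "rq * rt = q / a"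
    and nz: "\<alpha> \<noteq> 0" "s1 \<noteq> 0" "s2 \<noteq> 0"
  defines "G \<equiv> fps_expansion (g_fun q rq rt) 0"
  assumes m: "\<And>n. has_torus_mean (theta_weight q a (\<alpha> / s1)) (theta_weight q a (\<alpha> / s2))
     (\<lambda>p r. fps_nth (fps_scale r G * fps_scale p G * fps_scale (r * p) F) n) (m n)"
  shows "I_op q t rq rt \<alpha> s1 s2 F = fps_const (I_prefactor q t \<alpha> s1 * I_prefactor q t \<alpha> s2) *
     fps_expansion (h_fun q t) 0 * Abs_fps m"
proof -
  define W where "W = (\<lambda>s u. theta_q q (\<alpha> / s * (rq / rt) / u) / theta_q q (rq / rt / u) * g_fun q rq rt u)"
  define K where "K = {u. norm u = 1 \<and> qpoch_inf (q * u / a) q = 0}"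
  have K: "finite K" unfolding K_def by (rule finite_qpoch_zeros_on_circle[OF q a(2)])
  have W: "W s u = theta_weight q a (\<alpha> / s) u" if "norm u = 1" "u \<notin> K" "s \<noteq> 0" for s u
    unfolding W_def using that nz(1) by (intro theta_ratio_eq_theta_weight q a) (auto simp: K_def)
  have integrand: "fps_nth (I_integrand q rq rt \<alpha> s1 s2 F u1 u2) n =
      W s2 u2 * (W s1 u1 * fps_nth (fps_scale u2 G * fps_scale (1 / u1) G * fps_scale (u2 * (1 / u1)) F) n)" for u1 u2 n
    unfolding I_integrand_def fps_compose_linear fps_scale_def[symmetric] G_def[symmetric] W_def
    by (simp add: mult.assoc) (simp add: mult_ac)
  have "1 / (2 * of_real pi * \<i>) * contour_integral (circlepath 0 1) (\<lambda>u1.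
         1 / (2 * of_real pi * \<i>) * contour_integral (circlepath 0 1) (\<lambda>u2.
           fps_nth (I_integrand q rq rt \<alpha> s1 s2 F u1 u2) n / u2) / u1) = m n" (is "_ * contour_integral _ (\<lambda>u1. ?I u1 / u1) = _") for n
  proof -
    let ?f = "\<lambda>p r. fps_nth (fps_scale r G * fps_scale p G * fps_scale (r * p) F) n"
    obtain J where
      J: "\<And>u1. norm u1 = 1 \<Longrightarrow> has_circle_mean (\<lambda>u2. theta_weight q a (\<alpha> / s2) u2 * ?f (1 / u1) u2) (J u1)"
         "has_circle_mean (\<lambda>u1. theta_weight q a (\<alpha> / s1) u1 * J u1) (m n)"
      using m[of n] unfolding has_torus_mean_def by blast
    have inner: "?I u1 = W s1 u1 * J u1" if "norm u1 = 1" for u1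
    proof (rule has_circle_mean_imp_eq)
      show "has_circle_mean (\<lambda>u2. fps_nth (I_integrand q rq rt \<alpha> s1 s2 F u1 u2) n) (W s1 u1 * J u1)"
        by (rule has_circle_mean_spike[OF has_circle_mean_cmult[OF J(1)[OF that]] K])
           (simp add: integrand W nz mult_ac)
    qed
    show ?thesis
    proof (rule has_circle_mean_imp_eq)
      show "has_circle_mean ?I (m n)"
      proof (rule has_circle_mean_spike[OF J(2) K])
        fix u assume u: "norm u = 1" "u \<notin> K"
        show "?I u = theta_weight q a (\<alpha> / s1) u * J u"
          unfolding inner[OF u(1)] W[OF u nz(2)] ..
      qed
    qed
  qed
  thus ?thesis unfolding I_op_def by simp
qed

text \<open>In a Cauchy product only the coefficients \<open>k \<le> n\<close> of \<open>F\<close>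
  reach coefficient \<open>n\<close>. Each comes with a mean independent of \<open>F\<close>, which
  exists because its integrand is the weights times a polynomial in \<open>1 / u1\<close> and
  \<open>u2\<close>.\<close>

lemma I_op_triangular:
  fixes q t rq rt \<alpha> s1 s2 a :: complex
  assumes q: "0 < norm q" "norm q < 1" and a: "a = rq / rt" "a \<noteq> 0" "norm a < 1" "rq * rt = q / a"
    and nz: "\<alpha> \<noteq> 0" "s1 \<noteq> 0" "s2 \<noteq> 0" "q * (\<alpha> / s2) = \<alpha> / s1 * a\<^sup>2"
  obtains U where "\<And>F n. fps_nth (I_op q t rq rt \<alpha> s1 s2 F) n = (\<Sum>k\<le>n. U n k * fps_nth F k)"
proof -
  define G where "G = fps_expansion (g_fun q rq rt) 0"
  define P where "P = fps_const (I_prefactor q t \<alpha> s1 * I_prefactor q t \<alpha> s2) * fps_expansion (h_fun q t) 0"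
  have a0: "0 < norm a" using a by simp
  have b: "\<alpha> / s1 \<noteq> 0" "\<alpha> / s2 \<noteq> 0" using nz by auto
  let ?T = "has_torus_mean (theta_weight q a (\<alpha> / s1)) (theta_weight q a (\<alpha> / s2))"
  have "\<exists>m. ?T (\<lambda>p r. (r * p) ^ k * fps_nth (fps_scale r G * fps_scale p G) n) m" for k n
  proof (rule bipoly_imp_tmean[OF q a0 a(3) b nz(4)])
    have "bipoly_fps (\<lambda>p r. fps_scale (1 * p ^ 0 * r ^ 1) G * fps_scale (1 * p ^ 1 * r ^ 0) G)"
      by (intro bipoly_fps_mult bipoly_fps_scale)
    hence "bipoly (\<lambda>p r. fps_nth (fps_scale r G * fps_scale p G) n)"
      by (simp add: bipoly_fps_def)
    from bipoly_mult[OF bipoly_monom[of 1 k k] this]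
    show "bipoly (\<lambda>p r. (r * p) ^ k * fps_nth (fps_scale r G * fps_scale p G) n)"
      by (simp add: power_mult_distrib mult_ac)
  qed
  note ex = this
  define V where "V k n = (SOME m. ?T (\<lambda>p r. (r * p) ^ k * fps_nth (fps_scale r G * fps_scale p G) n) m)" for k n
  have V: "?T (\<lambda>p r. (r * p) ^ k * fps_nth (fps_scale r G * fps_scale p G) n) (V k n)" for k n
    unfolding V_def by (rule someI_ex[OF ex])
  have "?T (\<lambda>p r. fps_nth (fps_scale r G * fps_scale p G * fps_scale (r * p) F) n) (\<Sum>k\<le>n. fps_nth F k * V k (n - k))" for F n
  proof -
    have "fps_nth (fps_scale r G * fps_scale p G * fps_scale (r * p) F) n =
        (\<Sum>k\<le>n. fps_nth F k * ((r * p) ^ k * fps_nth (fps_scale r G * fps_scale p G) (n - k)))" for p r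
      unfolding mult.commute[of "fps_scale r G * fps_scale p G"] fps_mult_nth[of "fps_scale (r * p) F"]
      by (simp add: atMost_atLeast0 mult_ac)
    moreover have "?T (\<lambda>p r. \<Sum>k\<le>n. fps_nth F k * ((r * p) ^ k * fps_nth (fps_scale r G * fps_scale p G) (n - k)))
        (\<Sum>k\<le>n. fps_nth F k * V k (n - k))"
      by (intro has_torus_mean_sum has_torus_mean_cmult V)
    ultimately show ?thesis by simp
  qed
  hence I: "I_op q t rq rt \<alpha> s1 s2 F = P * Abs_fps (\<lambda>n. \<Sum>k\<le>n. fps_nth F k * V k (n - k))" for F
    unfolding P_def G_def by (rule I_op_eq[OF q a(1,2,4) nz(1,2,3)])
  show thesis
  proof (rule that)
    fix F n
    have "fps_nth (I_op q t rq rt \<alpha> s1 s2 F) n = (\<Sum>j\<le>n. \<Sum>k\<le>j. fps_nth P (n - j) * (fps_nth F k * V k (j - k)))"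
      unfolding I mult.commute[of P] fps_mult_nth
      by (simp add: atMost_atLeast0 sum_distrib_left mult_ac)
    \<comment> \<open>The triangular double sum is padded with zeros to a square so that the order
      of summation can be swapped.\<close>
    also have "\<dots> = (\<Sum>j\<le>n. \<Sum>k\<le>n. if k \<le> j then fps_nth P (n - j) * (fps_nth F k * V k (j - k)) else 0)"
      by (intro sum.cong refl sum.mono_neutral_cong_left) auto
    also have "\<dots> = (\<Sum>k\<le>n. \<Sum>j\<le>n. if k \<le> j then fps_nth P (n - j) * (fps_nth F k * V k (j - k)) else 0)"
      by (rule sum.swap)
    also have "\<dots> = (\<Sum>k\<le>n. (\<Sum>j\<le>n. if k \<le> j then fps_nth P (n - j) * V k (j - k) else 0) * fps_nth F k)"
      unfolding sum_distrib_right by (intro sum.cong refl) auto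
    finally show "fps_nth (I_op q t rq rt \<alpha> s1 s2 F) n =
        (\<Sum>k\<le>n. (\<Sum>j\<le>n. if k \<le> j then fps_nth P (n - j) * V k (j - k) else 0) * fps_nth F k)" .
  qed
qed

text \<open>Applied to the series of \<open>h_fun\<close>, the integral is the constant product of
  the two zeroth moments, which the prefactors cancel; what remains is the outer factor
  \<open>h_fun\<close>.\<close>

lemma I_op_fixes_h_fun:
  fixes q t rq rt \<alpha> :: complex
  assumes q: "0 < norm q" "norm q < 1" and t: "t \<noteq> 0" "norm (q / t) < 1"
    and r: "rq\<^sup>2 = q" "rt\<^sup>2 = t"
    and "generic_params q t rq rt \<alpha> 1 t"
  shows "I_op q t rq rt \<alpha> 1 t (fps_expansion (h_fun q t) 0) = fps_expansion (h_fun q t) 0"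
    and "fps_nth (fps_expansion (h_fun q t) 0) 0 = 1"
proof -
  define a where "a = rq / rt"
  note sr = sqrt_ratio[OF q(1) t r, folded a_def]
  have a0: "a \<noteq> 0" "0 < norm a" and a1: "norm a < 1" and a2: "a\<^sup>2 = q / t"
    and rqrt: "rq * rt = q / a" "rq * rt = t * a"
    using sr by auto
  have gen: "\<alpha> \<noteq> 0" "qpoch_inf (\<alpha> / s * (q / t)) q \<noteq> 0" "qpoch_inf (s / \<alpha> * q) q \<noteq> 0" if "s \<in> {1, t}" for s
    using assms(7) that unfolding generic_params_def by blast+
  have \<alpha>: "\<alpha> \<noteq> 0" using gen by blast
  define G where "G = fps_expansion (g_fun q rq rt) 0"
  define k where "k = fps_expansion (\<lambda>z. qpoch_inf (q / t * z) q / qpoch_inf (t * z) q) 0"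
  \<comment> \<open>The rescaling removes \<open>a\<close>: \<open>G\<close> belongs to the quotient
    with arguments \<open>t * a * z\<close> and \<open>a * z\<close>, and \<open>C\<close> to the
    one with \<open>t * z\<close> and \<open>z\<close>.\<close>
  define C where "C = fps_scale (1 / a) G"
  define h where "h = fps_expansion (h_fun q t) 0"
  have G_eq: "G = fps_expansion (\<lambda>z. qpoch_inf (t * a * z) q / qpoch_inf (a * z) q) 0"
    unfolding G_def g_fun_def rqrt(2) a_def[symmetric] ..
  have k: "fps_scale q k * (1 - fps_const (q / t) * fps_X) = k * (1 - fps_const t * fps_X)" "fps_nth k 0 = 1"
    unfolding k_def by (rule qpoch_quotient_fps_scale[OF q(2)] fps_nth_qpoch_quotient_0[OF q(2)])+
  have h_eq: "h = (1 - fps_X) * k"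
    unfolding h_def h_fun_def k_def
    by (intro fps_expansion_eqI fps_expansion_intros qpoch_quotient_has_fps_expansion[OF q(2)])
  show "fps_nth (fps_expansion (h_fun q t) 0) 0 = 1" using k h_eq by (simp add: h_def)
  have GC: "G = fps_scale a C" using a0 by (simp add: C_def fps_eq_iff)
  have "fps_scale (1 / a) (fps_scale q G * (1 - fps_const (t * a) * fps_X)) = fps_scale (1 / a) (G * (1 - fps_const a * fps_X))"
    unfolding G_eq qpoch_quotient_fps_scale[OF q(2)] ..
  hence C: "fps_scale q C * (1 - fps_const t * fps_X) = C * (1 - fps_X)"
    using a0 unfolding fps_scale_mult fps_scale_linear C_def fps_scale_scale by (simp add: mult_ac)
  have C0: "fps_nth C 0 = 1"
    unfolding C_def G_eq using fps_nth_qpoch_quotient_0[OF q(2), of "t * a" a] by simp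
  have scaled: "fps_scale r G * fps_scale p G * fps_scale (r * p) h = fps_scale q (kernel_prod t C k (a / q * p) (a / q * r))" for p r
  proof -
    have "t * (a\<^sup>2 / q) = 1" using q t unfolding a2 by (simp add: field_simps)
    moreover have "q * (t * (a / q * p) * (a / q * r)) = t * (a\<^sup>2 / q) * (r * p)"
      using q by (simp add: field_simps power2_eq_square)
    ultimately have eq: "q * (a / q * p) = p * a" "q * (a / q * r) = r * a" "q * (t * (a / q * p) * (a / q * r)) = r * p"
      using q by simp_all
    show ?thesis
      unfolding kernel_prod_def fps_scale_mult[of q] fps_scale_scale eq h_eq GC by (simp only: mult.commute[of "fps_scale (p * a) C"])
  qed
  let ?M = "moment q a (\<alpha> / 1) 0 * moment q a (\<alpha> / t) 0"
  have b: "\<alpha> / 1 \<noteq> 0" "\<alpha> / t \<noteq> 0" "q * (\<alpha> / t) = \<alpha> / 1 * a\<^sup>2" using \<alpha> t a2 by auto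
  have mean: "has_torus_mean (theta_weight q a (\<alpha> / 1)) (theta_weight q a (\<alpha> / t))
     (\<lambda>p r. fps_nth (fps_scale r G * fps_scale p G * fps_scale (r * p) h) n) (fps_nth (fps_const ?M) n)" for n
  proof -
    \<comment> \<open>The rescaling by \<open>q\<close> in \<open>scaled\<close> multiplies the mean
      by \<open>q ^ n\<close>, which is harmless as only \<open>n = 0\<close> gives a nonzero
      mean.\<close>
    have "fps_nth (fps_const ?M) n = q ^ n * (if n = 0 then ?M else 0)" by simp
    thus ?thesis unfolding scaled fps_scale_nth
      by (simp only:) (rule has_torus_mean_cmult[OF tmean_kernel_prod[OF q a0(2) a1 b t(1) a2 C k(1) C0 k(2)]])
  qed
  have "I_op q t rq rt \<alpha> 1 t h = fps_const (I_prefactor q t \<alpha> 1 * I_prefactor q t \<alpha> t) *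
      fps_expansion (h_fun q t) 0 * Abs_fps (fps_nth (fps_const ?M))"
    by (rule I_op_eq[OF q a_def a0(1) rqrt(1) \<alpha> _ t(1)]) (use mean in \<open>simp_all add: G_def\<close>)
  also have "Abs_fps (fps_nth (fps_const ?M)) = fps_const ?M" by (rule fps_ext) simp
  also have "fps_const (I_prefactor q t \<alpha> 1 * I_prefactor q t \<alpha> t) * fps_expansion (h_fun q t) 0 * fps_const ?M
      = fps_const (I_prefactor q t \<alpha> 1 * moment q a (\<alpha> / 1) 0 * (I_prefactor q t \<alpha> t * moment q a (\<alpha> / t) 0)) * h"
    unfolding h_def by (simp only: fps_const_mult[symmetric] mult_ac)
  also have "\<dots> = h"
    using prefactor_times_moment[OF q a0(2) a1 a2 \<alpha> _ gen(2,3), of 1]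
      prefactor_times_moment[OF q a0(2) a1 a2 \<alpha> _ gen(2,3), of t] t(1) by simp
  finally show "I_op q t rq rt \<alpha> 1 t (fps_expansion (h_fun q t) 0) = fps_expansion (h_fun q t) 0"
    unfolding h_def .
qed

theorem proposition4p2:
  fixes q t rq rt \<alpha> :: complex and f0 :: "complex fps"
  assumes "0 < norm q" and "norm q < 1"
    and "t \<noteq> 0" and "norm (q / t) < 1"
    and "rq\<^sup>2 = q" and "rt\<^sup>2 = t"
    and "generic_params q t rq rt \<alpha> 1 t"
  shows "first_eigenfunction q t rq rt \<alpha> 1 t f0 \<longleftrightarrow>
    f0 = fps_expansion
      (\<lambda>z. (1 - z) * (qpoch_inf (q / t * z) q / qpoch_inf (t * z) q)) 0"
proof -
  let ?I = "I_op q t rq rt \<alpha> 1 t"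
  define h where "h = fps_expansion (h_fun q t) 0"
  have Ih: "?I h = h" and h0: "fps_nth h 0 = 1"
    unfolding h_def using I_op_fixes_h_fun[OF assms] by blast+
  define a where "a = rq / rt"
  note a = sqrt_ratio[OF assms(1,3-6), folded a_def]
  have \<alpha>: "\<alpha> \<noteq> 0" and simple: "\<And>k. k \<ge> 1 \<Longrightarrow> fps_nth (?I (fps_X ^ k)) k \<noteq> 1"
    using assms(7) unfolding generic_params_def by blast+
  have "q * (\<alpha> / t) = \<alpha> / 1 * a\<^sup>2" using a(3) by simp
  then obtain U where U: "\<And>F n. fps_nth (?I F) n = (\<Sum>k\<le>n. U n k * fps_nth F k)"
    using I_op_triangular[OF assms(1,2) a_def a(1,2,4) \<alpha> one_neq_zero assms(3)] by blast
  have diag: "U k k \<noteq> 1" if "k \<ge> 1" for k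
  proof -
    have "fps_nth (?I (fps_X ^ k)) k = (\<Sum>j\<le>k. if j = k then U k k else 0)"
      unfolding U by (intro sum.cong refl) (auto simp: fps_X_power_nth)
    thus ?thesis using simple[OF that] by simp
  qed
  \<comment> \<open>Read off from the fixed series \<open>h\<close>; it forces the eigenvalue of any
    eigenfunction with constant term 1 to be 1.\<close>
  have "U 0 0 = 1" using U[of h 0] Ih h0 by simp
  have "f0 = h" if f0: "fps_nth f0 0 = 1" "?I f0 = fps_const c * f0" for c
  proof (rule fps_ext)
    fix n
    have "c = 1" using U[of f0 0] f0 \<open>U 0 0 = 1\<close> by simp
    hence If0: "?I f0 = f0" using f0 by simp
    show "fps_nth f0 n = fps_nth h n"
    proof (induction n rule: less_induct)
      case (less n)
      show ?case
      proof (cases "n = 0")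
        case False
        \<comment> \<open>Isolating the diagonal term lets the lower coefficients determine the
          \<open>n\<close>-th one, because \<open>U n n\<close> differs from 1.\<close>
        have split: "fps_nth F n = (\<Sum>k<n. U n k * fps_nth F k) + U n n * fps_nth F n" if "?I F = F" for F
          using U[of F n] that by (simp add: lessThan_Suc_atMost[symmetric])
        have "(\<Sum>k<n. U n k * fps_nth f0 k) = (\<Sum>k<n. U n k * fps_nth h k)"
          using less.IH by (intro sum.cong) auto
        moreover have "(1 - U n n) * fps_nth F n = (\<Sum>k<n. U n k * fps_nth F k)" if "?I F = F" for F
          using split[OF that] by (metis add_diff_cancel_right' left_diff_distrib mult_1)
        ultimately have "(1 - U n n) * (fps_nth f0 n - fps_nth h n) = 0"
          using If0 Ih by (simp add: right_diff_distrib)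
        thus ?thesis using diag[of n] False by simp
      qed (use f0 h0 in simp)
    qed
  qed
  moreover have "?I h = fps_const 1 * h" using Ih by simp
  ultimately have "first_eigenfunction q t rq rt \<alpha> 1 t f0 \<longleftrightarrow> f0 = h"
    unfolding first_eigenfunction_def using h0 by blast
  thus ?thesis unfolding h_def h_fun_def .
qed

end
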